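(* Let $k\geq 1$ and $n\geq 2k$ be integers, and let $G=(X,Y)$ be a nearly balanced bipartite graph of order $2n-1$. If $\delta(G)\geq k$ and $$\mu(\widehat{G})\leq\sqrt{k(n-k)},$$ then $G$ is traceable, unless $G\in\bigcup_{1\leq j\leq n/2}\mathscr{C}_n^j$ or $G=\Gamma_2-v$, where $v$ is a vertex of $\Gamma_2$ with $d_{\Gamma_2}(v)=4$.
   Context: All graphs are finite and simple; equality of graphs is up to isomorphism. A bipartite graph with partite sets $X,Y$ is nearly balanced if $|X|=|Y|-1$. The quasi-complement $\widehat{G}$ of a bipartite graph $G=(X,Y;E)$ is the bipartite graph with the same partite sets $X,Y$ and edge set $\{xy: x\in X,\ y\in Y,\ xy\notin E\}$. $\delta(G)$ is the minimum degree, $d_H(v)$ is the degree of $v$ in a graph $H$, and $\mu(\cdot)$ is the spectral radius, i.e. the largest eigenvalue of the adjacency matrix. A graph is traceable if it contains a Hamiltonian path. Bipartite graphs are taken with fixed ordered partite sets: $O_{a,b}$ is the edgeless bipartite graph with first part of size $a$ and second part of size $b$. For bipartite graphs $G_1,G_2$ with bipartitions $(X_1,Y_1)$, $(X_2,Y_2)$, $G_1\sqcup G_2$ is the graph obtained from the disjoint union of $G_1$ and $G_2$ by adding all edges between $X_1$ and $Y_2$ and all edges between $Y_1$ and $X_2$. For an integer $1\leq j\leq n/2$, $\mathscr{C}_n^j$ is the set of all graphs $O_{j,n-j}\sqcup G_0$, where $G_0$ is any bipartite graph with first part of size $n-j-1$ and second part of size $j$. $\Gamma_2$ is the balanced bipartite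 graph on the $8$ vertices $a,b,x_1,x_2,x_3,y_1,y_2,y_3$ (with partite sets $\{a,x_1,x_2,x_3\}$ and $\{b,y_1,y_2,y_3\}$) whose edges are $ab$ and, for $i=1,2,3$, $ay_i$, $y_ix_i$, $x_ib$; its vertices of degree $4$ are $a$ and $b$. $\Gamma_2-v$ denotes deletion of the vertex $v$. *)

theory Defs
  imports
    Complex_Main
    "Graph_Theory.Graph_Theory"
    "Jordan_Normal_Form.Spectral_Radius"
begin

text \<open>
  A simple graph is a loop-free symmetric digraph without parallel arcs (locale \<^locale>\<open>graph\<close>),
  an edge being a pair of opposite arcs. Hence the degree of a vertex is its out-degree.
\<close>

definition min_degree :: "('a, 'b) pre_digraph \<Rightarrow> nat" where
  "min_degree G = Min (out_degree G ` verts G)"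

definition traceable :: "('a, 'b) pre_digraph \<Rightarrow> bool" where
  "traceable G \<longleftrightarrow> (\<exists>p. vpath p G \<and> set p = verts G)"

definition adj_matrix :: "('a, 'b) pre_digraph \<Rightarrow> 'a list \<Rightarrow> real mat" where
  "adj_matrix G vs = mat (length vs) (length vs)
     (\<lambda>(i, j). if (vs ! i, vs ! j) \<in> arcs_ends G then 1 else 0)"

text \<open>
  The enumeration of the vertices is immaterial: two enumerations give adjacency matrices that
  are conjugate by a permutation matrix. For a nonempty finite simple graph the adjacency matrix is
  real symmetric, so its real spectrum is finite and nonempty.
\<close>

definition spectral_rad :: "('a, 'b) pre_digraph \<Rightarrow> real" where
  "spectral_rad G = Max (spectrum (adj_matrix G (SOME vs. distinct vs \<and> set vs = verts G)))"

text \<open>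
  Bipartite graphs with fixed ordered partite sets. Every edge is recorded once, as a pair
  directed from the first part to the second; \<open>graph_of\<close> forgets the partition.
\<close>

record 'a bigraph =
  lpart :: "'a set"
  rpart :: "'a set"
  bedges :: "('a \<times> 'a) set"

definition bipartite_graph :: "'a bigraph \<Rightarrow> bool" where
  "bipartite_graph B \<longleftrightarrow> finite (lpart B) \<and> finite (rpart B) \<and> lpart B \<inter> rpart B = {} \<and>
     bedges B \<subseteq> lpart B \<times> rpart B"

definition graph_of :: "'a bigraph \<Rightarrow> ('a, 'a \<times> 'a) pre_digraph" where
  "graph_of B = with_proj
     \<lparr> pverts = lpart B \<union> rpart B, parcs = bedges B \<union> (bedges B)\<inverse> \<rparr>"

lemma graph_graph_of:
  assumes "bipartite_graph B"
  shows "graph (graph_of B)"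
proof -
  let ?P = "\<lparr> pverts = lpart B \<union> rpart B, parcs = bedges B \<union> (bedges B)\<inverse> \<rparr>"
  have fin: "finite (bedges B)"
    using assms by (auto simp: bipartite_graph_def intro: finite_subset)
  have "pair_graph ?P"
    using assms fin
    by unfold_locales (auto simp: bipartite_graph_def symmetric_def intro!: symI)
  then show ?thesis
    unfolding graph_of_def by (rule pair_graph.pair_graphD_graph)
qed

definition nearly_balanced :: "'a bigraph \<Rightarrow> bool" where
  "nearly_balanced B \<longleftrightarrow> card (lpart B) + 1 = card (rpart B)"

definition quasi_complement :: "'a bigraph \<Rightarrow> 'a bigraph" where
  "quasi_complement B = \<lparr> lpart = lpart B, rpart = rpart B,
     bedges = lpart B \<times> rpart B - bedges B \<rparr>"

definition edgeless :: "nat \<Rightarrow> nat \<Rightarrow> nat bigraph" where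
  "edgeless a b = \<lparr> lpart = {0..<a}, rpart = {a..<a + b}, bedges = {} \<rparr>"

definition cross_join :: "'a bigraph \<Rightarrow> 'b bigraph \<Rightarrow> ('a + 'b) bigraph" (infixl \<open>\<squnion>\<^sub>b\<close> 65) where
  "B\<^sub>1 \<squnion>\<^sub>b B\<^sub>2 = \<lparr>
     lpart = lpart B\<^sub>1 <+> lpart B\<^sub>2,
     rpart = rpart B\<^sub>1 <+> rpart B\<^sub>2,
     bedges = map_prod Inl Inl ` bedges B\<^sub>1 \<union> map_prod Inr Inr ` bedges B\<^sub>2
       \<union> Inl ` lpart B\<^sub>1 \<times> Inr ` rpart B\<^sub>2 \<union> Inr ` lpart B\<^sub>2 \<times> Inl ` rpart B\<^sub>1 \<rparr>"

text \<open>
  Graphs are only considered up to isomorphism, so the second summand may be taken on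
  vertices of type \<^typ>\<open>nat\<close>.
\<close>

definition C_family :: "nat \<Rightarrow> nat \<Rightarrow> (nat + nat) bigraph set" where
  "C_family n j = {edgeless j (n - j) \<squnion>\<^sub>b G\<^sub>0 | G\<^sub>0 :: nat bigraph.
     bipartite_graph G\<^sub>0 \<and> card (lpart G\<^sub>0) = n - j - 1 \<and> card (rpart G\<^sub>0) = j}"

datatype gamma_vertex = va | vb | vx1 | vx2 | vx3 | vy1 | vy2 | vy3

definition Gamma2 :: "gamma_vertex bigraph" where
  "Gamma2 = \<lparr> lpart = {va, vx1, vx2, vx3}, rpart = {vb, vy1, vy2, vy3},
     bedges = {(va, vb),
       (va, vy1), (va, vy2), (va, vy3),
       (vx1, vy1), (vx2, vy2), (vx3, vy3),
       (vx1, vb), (vx2, vb), (vx3, vb)} \<rparr>"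

end

theory Submission
  imports Defs "HOL-Analysis.Function_Topology"
begin

text \<open>
  A Hamiltonian path of a nearly balanced bipartite graph \<open>G\<close> begins and ends in the larger part
  \<open>Y\<close>. Adding to the smaller part a vertex \<open>None\<close> joined to all of \<open>Y\<close> therefore turns
  traceability of \<open>G\<close> into Hamiltonicity of a balanced graph with parts of size \<open>n\<close>
  (\<open>traceable_if_hamiltonian_add_universal\<close>).

  Suppose that graph is not Hamiltonian, and let \<open>F\<close> be an edge-maximal non-Hamiltonian
  bipartite supergraph of it. Any nonadjacent pair \<open>x\<close>, \<open>y\<close> of \<open>F\<close> is joined by a Hamiltonian
  path of \<open>F\<close>, so Ore's crossing argument gives \<open>deg x + deg y \<le> n\<close>. Let \<open>N\<close> be the set of
  nonedges of \<open>F\<close>, a subgraph of the quasi-complement of \<open>G\<close>. The degree sum bound and the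
  minimum degree condition force \<open>deg\<^sub>N x * deg\<^sub>N y \<ge> k (n - k)\<close> for every edge \<open>xy\<close>
  of \<open>N\<close>, with equality only if \<open>deg\<^sub>N x = n - k\<close> and \<open>deg\<^sub>N y = k\<close>
  (\<open>degree_product_bound\<close>).

  Testing the Rayleigh quotient of the quasi-complement with the vector
  \<open>u \<mapsto> sqrt (deg\<^sub>N u)\<close> shows that its spectral radius is at least \<open>sqrt (k (n - k))\<close>.
  By hypothesis it is at most this number, so the test vector is an eigenvector and all
  inequalities are equalities (\<open>spectral_equality\<close>): the degrees in \<open>N\<close> are as
  above, and no edge of the quasi-complement joins the support of \<open>N\<close> to its complement.

  It remains to identify \<open>N\<close>. In \<open>F\<close> every nonadjacent pair has degrees \<open>k\<close> and \<open>n - k\<close>,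
  so the crossing argument is tight for every Hamiltonian path joining nonadjacent vertices, in
  particular for the rotations of one such path. Comparing these paths shows that \<open>N\<close> is
  a complete bipartite graph on parts of size \<open>k\<close> and \<open>n - k\<close> (\<open>extremal_nonham\<close>). Hence
  \<open>G\<close> belongs to \<open>C_family n k\<close>. The condition \<open>2 * k < n\<close> that this step uses
  follows from the degrees in \<open>N\<close>.
\<close>

section \<open>Hamiltonian cycles of balanced bipartite graphs\<close>

text \<open>
  A bipartite graph is given by pairs directed from the first part to the second, so adjacency is
  the symmetric closure of its edge relation.
\<close>

definition adj :: "('v \<times> 'v) set \<Rightarrow> 'v \<Rightarrow> 'v \<Rightarrow> bool" where
  "adj E u w \<longleftrightarrow> (u, w) \<in> E \<or> (w, u) \<in> E"

definition deg :: "('v \<times> 'v) set \<Rightarrow> 'v \<Rightarrow> nat" where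
  "deg E u = card {w. adj E u w}"

definition ham_cycle :: "('v \<times> 'v) set \<Rightarrow> 'v set \<Rightarrow> 'v list \<Rightarrow> bool" where
  "ham_cycle E V c \<longleftrightarrow> c \<noteq> [] \<and> distinct c \<and> set c = V \<and> successively (adj E) c
     \<and> adj E (last c) (hd c)"

definition hamiltonian :: "('v \<times> 'v) set \<Rightarrow> 'v set \<Rightarrow> bool" where
  "hamiltonian E V \<longleftrightarrow> (\<exists>c. ham_cycle E V c)"

lemma adj_commute: "adj E u w \<longleftrightarrow> adj E w u"
  by (auto simp: adj_def)

lemma ham_cycle_append_commute:
  "ham_cycle E V (xs @ ys) \<Longrightarrow> ham_cycle E V (ys @ xs)"
  by (cases "xs = []"; cases "ys = []")
     (auto simp: ham_cycle_def successively_append_iff hd_append last_append)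

lemma ham_cycle_rev:
  assumes "ham_cycle E V c" shows "ham_cycle E V (rev c)"
proof -
  have "(\<lambda>u w. adj E w u) = adj E" by (auto simp: adj_def fun_eq_iff)
  then have "successively (adj E) (rev c) \<longleftrightarrow> successively (adj E) c"
    unfolding successively_rev by (rule arg_cong[where f = "\<lambda>R. successively R c"])
  then show ?thesis
    using assms adj_commute[of E "last c" "hd c"]
    by (auto simp: ham_cycle_def hd_rev last_rev simp del: successively_rev)
qed

lemma ham_cycle_from:
  assumes "ham_cycle E V c" "u \<in> V"
  obtains d where "ham_cycle E V (u # d)"
proof -
  have "u \<in> set c" using assms by (simp add: ham_cycle_def)
  then obtain xs ys where "c = xs @ u # ys" by (auto simp: in_set_conv_decomp)
  then have "ham_cycle E V (u # (ys @ xs))"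
    using assms(1) ham_cycle_append_commute[of E V xs "u # ys"] by simp
  then show thesis by (rule that)
qed

text \<open>
  Every Hamiltonian cycle below is a rearrangement of the vertices of a given Hamiltonian path \<open>v\<close>.
  The rearrangement is written as a list of indices, so that distinctness and covering become facts
  about intervals of numbers.
\<close>

lemma hamiltonian_reorderI:
  assumes "bij_betw v {..<m} V" "distinct js" "set js = {..<m}" "js \<noteq> []"
    and "successively (\<lambda>i j. adj E (v i) (v j)) js" "adj E (v (last js)) (v (hd js))"
  shows "hamiltonian E V"
  unfolding hamiltonian_def ham_cycle_def using assms
  by (intro exI[of _ "map v js"])
     (auto simp: distinct_map bij_betw_def successively_map last_map hd_map)

lemma successively_upt:
  assumes "\<And>i. a \<le> i \<Longrightarrow> Suc i < b \<Longrightarrow> R i (Suc i)"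
  shows "successively R [a..<b]"
  using assms by (auto simp: successively_conv_nth)

locale balanced_bipartite =
  fixes X Y :: "'v set" and E :: "('v \<times> 'v) set" and n :: nat
  assumes finite_X: "finite X" and finite_Y: "finite Y"
    and card_X: "card X = n" and card_Y: "card Y = n"
    and disjoint: "X \<inter> Y = {}" and E_sub: "E \<subseteq> X \<times> Y"
begin

text \<open>
  A Hamiltonian path that starts in \<open>X\<close>: its \<open>i\<close>-th vertex in \<open>X\<close> is \<open>v (2 * i)\<close> and
  its \<open>i\<close>-th vertex in \<open>Y\<close> is \<open>v (2 * i + 1)\<close>, for \<open>i < n\<close>.
\<close>

definition zigzag :: "(nat \<Rightarrow> 'v) \<Rightarrow> bool" where
  "zigzag v \<longleftrightarrow> bij_betw v {..<2 * n} (X \<union> Y)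
     \<and> (\<forall>i<n. v (2 * i) \<in> X \<and> v (2 * i + 1) \<in> Y)
     \<and> (\<forall>i. Suc i < 2 * n \<longrightarrow> adj E (v i) (v (Suc i)))"

lemma adj_iff: "x \<in> X \<Longrightarrow> y \<in> Y \<Longrightarrow> adj E x y \<longleftrightarrow> (x, y) \<in> E"
  using disjoint E_sub by (auto simp: adj_def)

lemma adj_sub_right: "x \<in> X \<Longrightarrow> adj E x w \<Longrightarrow> w \<in> Y"
  and adj_sub_left: "y \<in> Y \<Longrightarrow> adj E y w \<Longrightarrow> w \<in> X"
  using disjoint E_sub by (auto simp: adj_def)

context
  fixes v
  assumes zz: "zigzag v"
begin

lemma inj_zigzag: "inj_on v {..<2 * n}"
  using zz by (auto simp: zigzag_def bij_betw_def)

lemma odd_zigzag: "bij_betw (\<lambda>i. v (2 * i + 1)) {..<n} Y"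
proof -
  have "inj_on (\<lambda>i. v (2 * i + 1)) {..<n}"
    using inj_zigzag by (auto intro!: inj_onI dest: inj_onD)
  moreover have "(\<lambda>i. v (2 * i + 1)) ` {..<n} \<subseteq> Y"
    using zz by (auto simp: zigzag_def)
  ultimately show ?thesis
    using card_Y finite_Y by (simp add: bij_betw_def card_image card_subset_eq)
qed

lemma even_zigzag: "bij_betw (\<lambda>i. v (2 * i)) {..<n} X"
proof -
  have "inj_on (\<lambda>i. v (2 * i)) {..<n}"
    using inj_zigzag by (auto intro!: inj_onI dest: inj_onD)
  moreover have "(\<lambda>i. v (2 * i)) ` {..<n} \<subseteq> X"
    using zz by (auto simp: zigzag_def)
  ultimately show ?thesis
    using card_X finite_X by (simp add: bij_betw_def card_image card_subset_eq)
qed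

lemma deg_left_zigzag:
  assumes "x \<in> X" shows "deg E x = card {i. i < n \<and> adj E x (v (2 * i + 1))}"
proof -
  have "{w. adj E x w} = (\<lambda>i. v (2 * i + 1)) ` {i. i < n \<and> adj E x (v (2 * i + 1))}"
    using adj_sub_right[OF assms] odd_zigzag by (auto simp: bij_betw_def)
  moreover have "inj_on (\<lambda>i. v (2 * i + 1)) {i. i < n \<and> adj E x (v (2 * i + 1))}"
    using odd_zigzag by (auto simp: bij_betw_def inj_on_def)
  ultimately show ?thesis by (simp add: deg_def card_image)
qed

lemma deg_right_zigzag:
  assumes "y \<in> Y" shows "deg E y = card {i. i < n \<and> adj E (v (2 * i)) y}"
proof -
  have "{w. adj E y w} = (\<lambda>i. v (2 * i)) ` {i. i < n \<and> adj E (v (2 * i)) y}"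
    using adj_sub_left[OF assms] even_zigzag by (auto simp: bij_betw_def adj_commute[of E y])
  moreover have "inj_on (\<lambda>i. v (2 * i)) {i. i < n \<and> adj E (v (2 * i)) y}"
    using even_zigzag by (auto simp: bij_betw_def inj_on_def)
  ultimately show ?thesis by (simp add: deg_def card_image)
qed

lemma zigzag_step: "Suc i < 2 * n \<Longrightarrow> adj E (v i) (v (Suc i))"
  using zz by (auto simp: zigzag_def)

lemma zigzag_segment: "b \<le> 2 * n \<Longrightarrow> successively (\<lambda>i j. adj E (v i) (v j)) [a..<b]"
  by (rule successively_upt) (auto intro: zigzag_step)

lemma zigzag_segment_rev: "b \<le> 2 * n \<Longrightarrow> successively (\<lambda>i j. adj E (v i) (v j)) (rev [a..<b])"
  using zigzag_segment unfolding successively_rev by (subst adj_commute)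

lemma zigzag_cycleI:
  assumes "distinct js" "set js = {..<2 * n}" "js \<noteq> []"
    and "successively (\<lambda>i j. adj E (v i) (v j)) js" "adj E (v (last js)) (v (hd js))"
  shows "hamiltonian E (X \<union> Y)"
  using hamiltonian_reorderI assms zz unfolding zigzag_def by blast

context
  assumes nonham: "\<not> hamiltonian E (X \<union> Y)"
begin

text \<open>
  If both edges existed, one could walk from \<open>v 0\<close> to \<open>v (2 * i)\<close>, jump to the last
  vertex, walk back to \<open>v (2 * i + 1)\<close> and return to \<open>v 0\<close>.
\<close>

lemma crossing:
  assumes "i < n" "adj E (v 0) (v (2 * i + 1))"
  shows "\<not> adj E (v (2 * i)) (v (2 * n - 1))"
proof
  assume a: "adj E (v (2 * i)) (v (2 * n - 1))"
  let ?js = "[0..<2 * i + 1] @ rev [2 * i + 1..<2 * n]"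
  have "hamiltonian E (X \<union> Y)"
  proof (rule zigzag_cycleI[of ?js])
    show "successively (\<lambda>i j. adj E (v i) (v j)) ?js"
      using assms a zigzag_segment[of "2 * i + 1" 0] zigzag_segment_rev[of "2 * n" "2 * i + 1"]
      unfolding successively_append_iff by (simp add: hd_rev last_rev del: upt_Suc)
    show "adj E (v (last ?js)) (v (hd ?js))"
      using assms by (simp add: hd_append last_rev adj_commute[of E "v 0"] del: upt_Suc)
  qed (use assms in auto)
  then show False using nonham by blast
qed

text \<open>
  By the previous lemma the neighbours of the two ends occupy disjoint sets of indices below \<open>n\<close>.
  If the degrees sum to \<open>n\<close>, these sets partition the indices, so each index belongs to
  exactly one of them.
\<close>

lemma crossing_deg_sum:
  assumes "n > 0"
  shows "deg E (v 0) + deg E (v (2 * n - 1)) \<le> n"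
    and "n \<le> deg E (v 0) + deg E (v (2 * n - 1)) \<Longrightarrow> i < n \<Longrightarrow>
      adj E (v 0) (v (2 * i + 1)) \<longleftrightarrow> \<not> adj E (v (2 * i)) (v (2 * n - 1))"
proof -
  let ?S = "{i. i < n \<and> adj E (v 0) (v (2 * i + 1))}"
  let ?T = "{i. i < n \<and> adj E (v (2 * i)) (v (2 * n - 1))}"
  have "v (2 * 0) \<in> X" "v (2 * (n - 1) + 1) \<in> Y"
    using zz assms unfolding zigzag_def by auto
  moreover have "2 * (n - 1) + 1 = 2 * n - 1" using assms by simp
  ultimately have d: "deg E (v 0) = card ?S" "deg E (v (2 * n - 1)) = card ?T"
    using deg_left_zigzag deg_right_zigzag by auto
  have "?S \<inter> ?T = {}" using crossing by auto
  then have u: "card (?S \<union> ?T) = deg E (v 0) + deg E (v (2 * n - 1))"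
    unfolding d by (intro card_Un_disjoint) auto
  have sub: "?S \<union> ?T \<subseteq> {..<n}" by auto
  then show "deg E (v 0) + deg E (v (2 * n - 1)) \<le> n"
    using card_mono[OF _ sub] u by simp
  assume "n \<le> deg E (v 0) + deg E (v (2 * n - 1))" and i: "i < n"
  then have "?S \<union> ?T = {..<n}" using card_mono[OF _ sub] u sub by (intro card_subset_eq) auto
  then have "i \<in> ?S \<union> ?T" using i by blast
  then show "adj E (v 0) (v (2 * i + 1)) \<longleftrightarrow> \<not> adj E (v (2 * i)) (v (2 * n - 1))"
    using crossing i by blast
qed

end
end

text \<open>
  When the last vertex is adjacent to \<open>v (2 * i)\<close>, reversing the part of the path after
  \<open>v (2 * i)\<close> gives a Hamiltonian path from \<open>v 0\<close> to \<open>v (2 * i + 1)\<close>.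
\<close>

lemma zigzag_rotate:
  assumes zz: "zigzag v" and i: "i < n" and a: "adj E (v (2 * i)) (v (2 * n - 1))"
  defines "\<pi> \<equiv> (\<lambda>j. if j \<le> 2 * i then j else 2 * n + 2 * i - j)"
  shows "zigzag (v \<circ> \<pi>)"
proof -
  have "bij_betw \<pi> {..<2 * n} {..<2 * n}"
  proof (rule bij_betw_byWitness[where f' = \<pi>])
    show "\<forall>j\<in>{..<2 * n}. \<pi> (\<pi> j) = j" "\<forall>j\<in>{..<2 * n}. \<pi> (\<pi> j) = j"
      using i by (auto simp: \<pi>_def)
    show "\<pi> ` {..<2 * n} \<subseteq> {..<2 * n}" "\<pi> ` {..<2 * n} \<subseteq> {..<2 * n}"
      using i by (auto simp: \<pi>_def)
  qed
  then have "bij_betw (v \<circ> \<pi>) {..<2 * n} (X \<union> Y)"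
    using zz bij_betw_trans unfolding zigzag_def by blast
  moreover have "(v \<circ> \<pi>) (2 * j) \<in> X \<and> (v \<circ> \<pi>) (2 * j + 1) \<in> Y" if j: "j < n" for j
  proof -
    have "\<pi> (2 * j) = (if j \<le> i then 2 * j else 2 * (n + i - j))"
      "\<pi> (2 * j + 1) = (if j < i then 2 * j + 1 else 2 * (n + i - j - 1) + 1)"
      using i j by (auto simp: \<pi>_def)
    moreover have "v (2 * m) \<in> X \<and> v (2 * m + 1) \<in> Y" if "m < n" for m
      using zz that by (auto simp: zigzag_def)
    ultimately show ?thesis using i j by auto
  qed
  moreover have "adj E ((v \<circ> \<pi>) j) ((v \<circ> \<pi>) (Suc j))" if j: "Suc j < 2 * n" for j
  proof -
    consider "j < 2 * i" | "j = 2 * i" | "j > 2 * i" by linarith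
    then show ?thesis
    proof cases
      case 3
      then have "adj E (v (2 * n + 2 * i - Suc j)) (v (Suc (2 * n + 2 * i - Suc j)))"
        using i j by (intro zigzag_step[OF zz]) simp
      moreover have "Suc (2 * n + 2 * i - Suc j) = 2 * n + 2 * i - j" using i j by simp
      ultimately show ?thesis using 3 adj_commute[of E] by (simp add: \<pi>_def)
    qed (use zigzag_step[OF zz] a j in \<open>auto simp: \<pi>_def\<close>)
  qed
  ultimately show ?thesis by (simp add: zigzag_def)
qed

text \<open>
  Fix a Hamiltonian path \<open>v\<close> between nonadjacent ends and write \<open>\<sigma> i\<close> if the first end is
  adjacent to the \<open>i\<close>-th vertex of \<open>Y\<close>. Since the degrees of the ends sum to \<open>n\<close>, the last
  end is adjacent to the \<open>i\<close>-th vertex of \<open>X\<close> precisely when \<open>\<sigma> i\<close> fails. The same dichotomy for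
  the rotated paths determines all neighbours of those vertices of \<open>Y\<close> at which \<open>\<sigma>\<close> fails.
  The key point is that \<open>\<sigma>\<close> is an initial segment, necessarily \<open>{..<k}\<close>: otherwise one of two
  rearrangements of the path is a Hamiltonian cycle. The first \<open>k\<close> vertices of \<open>X\<close> and the last
  \<open>n - k\<close> vertices of \<open>Y\<close> then span no edge, and counting degrees shows that there is no other
  nonadjacent pair.
\<close>

lemma extremal_nonham:
  assumes nonham: "\<not> hamiltonian E (X \<union> Y)" and k: "2 * k < n" "k \<ge> 1"
    and v: "zigzag v" "\<not> adj E (v 0) (v (2 * n - 1))"
    and tight: "\<And>x y. x \<in> X \<Longrightarrow> y \<in> Y \<Longrightarrow> (x, y) \<notin> E \<Longrightarrow> deg E x = k \<and> deg E y = n - k"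
  obtains P Q where "P \<subseteq> X" "card P = k" "Q \<subseteq> Y" "card Q = n - k" "X \<times> Y - E = P \<times> Q"
proof -
  define \<sigma> where "\<sigma> i \<longleftrightarrow> adj E (v 0) (v (2 * i + 1))" for i
  have inX: "v (2 * i) \<in> X" and inY: "v (2 * i + 1) \<in> Y" if "i < n" for i
    using v that by (auto simp: zigzag_def)
  have "2 * (n - 1) + 1 = 2 * n - 1" using k by simp
  then have v0: "v 0 \<in> X" and vl: "v (2 * n - 1) \<in> Y"
    using inX[of 0] inY[of "n - 1"] k by auto
  have n0: "n > 0" using k by simp
  have last: "\<sigma> i \<longleftrightarrow> \<not> adj E (v (2 * i)) (v (2 * n - 1))" if "i < n" for i
    unfolding \<sigma>_def using tight[OF v0 vl] v(2) adj_iff[OF v0 vl] k that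
    by (intro crossing_deg_sum(2)[OF v(1) nonham n0]) auto
  \<comment> \<open>the dichotomy for the path rotated so as to end at the \<open>i\<close>-th vertex of \<open>Y\<close>\<close>
  have inner: "adj E (v (2 * j)) (v (2 * i + 1)) \<longleftrightarrow> \<not> \<sigma> (if j \<le> i then j else j - 1)"
    if i: "i < n" "\<not> \<sigma> i" and j: "j < n" for i j
  proof -
    define \<pi> where "\<pi> = (\<lambda>j. if j \<le> 2 * i then j else 2 * n + 2 * i - j)"
    have zz: "zigzag (v \<circ> \<pi>)"
      unfolding \<pi>_def using last i by (intro zigzag_rotate[OF v(1)]) auto
    have ends: "(v \<circ> \<pi>) 0 = v 0" "(v \<circ> \<pi>) (2 * n - 1) = v (2 * i + 1)"
      using i by (auto simp: \<pi>_def)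
    have "(v 0, v (2 * i + 1)) \<notin> E"
      using i adj_iff v0 inY unfolding \<sigma>_def by blast
    then have "n \<le> deg E ((v \<circ> \<pi>) 0) + deg E ((v \<circ> \<pi>) (2 * n - 1))"
      unfolding ends using tight[OF v0 inY] i k by simp
    then have c: "adj E (v 0) ((v \<circ> \<pi>) (2 * m + 1)) \<longleftrightarrow> \<not> adj E ((v \<circ> \<pi>) (2 * m)) (v (2 * i + 1))"
      if "m < n" for m
      using crossing_deg_sum(2)[OF zz nonham n0 _ that] unfolding ends by blast
    consider "j < i" | "j = i" | "j > i" by linarith
    then show ?thesis
    proof cases
      case 1
      then show ?thesis using c[of j] j by (simp add: \<pi>_def \<sigma>_def)
    next
      case 2
      then show ?thesis using i zigzag_step[OF v(1), of "2 * i"] by auto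
    next
      case 3
      then have "(v \<circ> \<pi>) (2 * (n + i - j)) = v (2 * j)"
        "(v \<circ> \<pi>) (2 * (n + i - j) + 1) = v (2 * (j - 1) + 1)" "n + i - j < n"
        using j by (auto simp: \<pi>_def algebra_simps diff_mult_distrib2 intro!: arg_cong[of _ _ v])
      then show ?thesis using c[of "n + i - j"] 3 by (simp add: \<sigma>_def)
    qed
  qed
  have card_\<sigma>: "card {i. i < n \<and> \<sigma> i} = k"
    using deg_left_zigzag[OF v(1) v0] tight[OF v0 vl] v(2) adj_iff[OF v0 vl] by (simp add: \<sigma>_def)
  have \<sigma>0: "\<sigma> 0" using zigzag_step[OF v(1), of 0] n0 by (simp add: \<sigma>_def)
  have initial: "\<sigma> i" if ij: "i < j" "j < n" "\<sigma> j" for i j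
  proof (rule ccontr)
    assume ni: "\<not> \<sigma> i"
    \<comment> \<open>\<open>\<sigma>\<close> fails at \<open>n - k > k\<close> places and holds at \<open>0\<close>, so it fails at two consecutive places\<close>
    have "\<exists>m. Suc m < n \<and> \<not> \<sigma> m \<and> \<not> \<sigma> (Suc m)"
    proof (rule ccontr)
      assume "\<not> ?thesis"
      then have *: "\<sigma> m" if "Suc m < n" "\<not> \<sigma> (Suc m)" for m using that by blast
      let ?N = "{i. i < n \<and> \<not> \<sigma> i}"
      have "card ?N \<le> card {i. i < n \<and> \<sigma> i}"
      proof (rule card_inj_on_le[where f = "\<lambda>i. i - 1"])
        have "i > 0" if "i \<in> ?N" for i using that \<sigma>0 by (cases i) auto
        then show "inj_on (\<lambda>i. i - 1) ?N" by (auto simp: inj_on_def) (metis Suc_pred)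
        show "(\<lambda>i. i - 1) ` ?N \<subseteq> {i. i < n \<and> \<sigma> i}"
        proof safe
          fix i assume i: "i < n" "\<not> \<sigma> i"
          then obtain m where "i = Suc m" using \<sigma>0 by (cases i) auto
          then show "i - 1 < n" "\<sigma> (i - 1)" using * i by auto
        qed
      qed simp
      moreover have "card ?N + card {i. i < n \<and> \<sigma> i} = card (?N \<union> {i. i < n \<and> \<sigma> i})"
        by (subst card_Un_disjoint) auto
      moreover have "?N \<union> {i. i < n \<and> \<sigma> i} = {..<n}" by auto
      ultimately show False using k card_\<sigma> by simp
    qed
    then obtain m where m: "Suc m < n" "\<not> \<sigma> m" "\<not> \<sigma> (Suc m)" by blast
    \<comment> \<open>at the first later index \<open>b\<close> with \<open>\<sigma> b\<close>, a path with two reversed segments closes up\<close>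
    have after: "\<not> \<sigma> l" if l: "m \<le> l" "l < n" for l
    proof
      assume "\<sigma> l"
      define b where "b = (LEAST b. m \<le> b \<and> \<sigma> b)"
      have b: "m \<le> b" "\<sigma> b" using LeastI[of "\<lambda>b. m \<le> b \<and> \<sigma> b" l] l \<open>\<sigma> l\<close> by (auto simp: b_def)
      have "b \<le> l" using l \<open>\<sigma> l\<close> by (auto simp: b_def intro: Least_le)
      have "b \<noteq> m" "b \<noteq> Suc m" using b m by auto
      then have bm: "Suc m < b" using b by simp
      have "\<not> \<sigma> (b - 1)"
        using not_less_Least[of "b - 1" "\<lambda>b. m \<le> b \<and> \<sigma> b"] bm unfolding b_def[symmetric] by auto
      then have e1: "adj E (v (2 * m + 1)) (v (2 * b))"
        using inner[of m b] m bm \<open>b \<le> l\<close> l adj_commute[of E "v (2 * m + 1)"] by auto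
      have e2: "adj E (v (2 * m + 2)) (v (2 * n - 1))" using last[of "Suc m"] m by simp
      have e3: "adj E (v (2 * b + 1)) (v 0)" using b adj_commute[of E "v 0"] by (auto simp: \<sigma>_def)
      let ?js = "[0..<2 * m + 2] @ rev [2 * m + 2..<2 * b + 1] @ rev [2 * b + 1..<2 * n]"
      have bn: "b < n" using \<open>b \<le> l\<close> l by simp
      have "hamiltonian E (X \<union> Y)"
      proof (rule zigzag_cycleI[OF v(1), of ?js])
        show "successively (\<lambda>i j. adj E (v i) (v j)) ?js"
          using e1 e2 zigzag_segment[OF v(1), of "2 * m + 2" 0] bm bn
            zigzag_segment_rev[OF v(1), of "2 * b + 1" "2 * m + 2"]
            zigzag_segment_rev[OF v(1), of "2 * n" "2 * b + 1"]
          unfolding successively_append_iff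
          by (simp add: hd_rev last_rev del: upt_Suc)
        show "adj E (v (last ?js)) (v (hd ?js))"
          using e3 bn by (simp add: hd_append last_rev del: upt_Suc)
      qed (use bm bn in auto)
      then show False using nonham by blast
    qed
    \<comment> \<open>the remaining case: all of \<open>\<sigma>\<close> lies before \<open>m\<close>, with a gap at \<open>a\<close> and its last element \<open>L\<close> beyond it\<close>
    define a where "a = (LEAST a. \<not> \<sigma> a)"
    have a: "\<not> \<sigma> a" "a \<le> i" using ni LeastI[of "\<lambda>a. \<not> \<sigma> a"] Least_le[of "\<lambda>a. \<not> \<sigma> a"] unfolding a_def by auto
    define L where "L = (GREATEST L. L < n \<and> \<sigma> L)"
    have L: "L < n" "\<sigma> L"
      using GreatestI_nat[of "\<lambda>L. L < n \<and> \<sigma> L" j n] ij by (auto simp: L_def)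
    have Lg: "l \<le> L" if "l < n" "\<sigma> l" for l
      unfolding L_def using that by (intro Greatest_le_nat[of _ _ n]) auto
    have aL: "a < L" using a ij Lg[of j] by simp
    have Lm: "L < m" using after[of L] L by force
    have "\<not> \<sigma> (Suc L)" using Lg[of "Suc L"] Lm m by force
    have f1: "adj E (v (2 * L + 1)) (v 0)" using L adj_commute[of E "v 0"] by (auto simp: \<sigma>_def)
    have f2: "adj E (v (2 * a)) (v (2 * n - 1))" using last[of a] a aL L by auto
    have f3: "adj E (v (2 * n - 1)) (v (2 * L + 2))"
      using last[of "Suc L"] \<open>\<not> \<sigma> (Suc L)\<close> Lm m adj_commute[of E "v (2 * n - 1)"] by auto
    \<comment> \<open>\<open>\<sigma>\<close> fails at both \<open>n - 2\<close> and \<open>n - 1\<close>, so \<open>inner\<close> applies to the last vertex of \<open>X\<close>\<close>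
    have f4: "adj E (v (2 * n - 2)) (v (2 * a + 1))"
    proof -
      have "\<not> \<sigma> (n - 1 - 1)" using after m by simp
      then have "adj E (v (2 * (n - 1))) (v (2 * a + 1))"
        using inner[of a "n - 1"] a aL Lm m by auto
      moreover have "2 * (n - 1) = 2 * n - 2" by simp
      ultimately show ?thesis by metis
    qed
    let ?js = "[2 * a + 1..<2 * L + 2] @ [0..<2 * a + 1] @ [2 * n - 1] @ [2 * L + 2..<2 * n - 1]"
    have "hamiltonian E (X \<union> Y)"
    proof (rule zigzag_cycleI[OF v(1), of ?js])
      show "successively (\<lambda>i j. adj E (v i) (v j)) ?js"
        using f1 f2 f3 aL Lm m zigzag_segment[OF v(1), of "2 * L + 2" "2 * a + 1"]
          zigzag_segment[OF v(1), of "2 * a + 1" 0] zigzag_segment[OF v(1), of "2 * n - 1" "2 * L + 2"]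
        unfolding successively_append_iff by (simp del: upt_Suc)
      have "2 * n - 1 - 1 = 2 * n - 2" "\<not> 2 * n - 1 \<le> 2 * L + 2" using Lm m by simp_all
      then show "adj E (v (last ?js)) (v (hd ?js))"
        using f4 aL Lm m by (simp add: hd_append del: upt_Suc)
    qed (use aL Lm m in auto)
    then show False using nonham by blast
  qed
  have \<sigma>_iff: "\<sigma> i \<longleftrightarrow> i < k" if "i < n" for i
  proof -
    let ?S = "{i. i < n \<and> \<sigma> i}"
    show ?thesis
    proof
      assume "\<sigma> i"
      then have "{..i} \<subseteq> ?S" using initial that by (auto simp: le_less)
      then have "card {..i} \<le> card ?S" by (intro card_mono) auto
      then show "i < k" using card_\<sigma> by simp
    next
      assume "i < k"
      show "\<sigma> i"
      proof (rule ccontr)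
        assume "\<not> \<sigma> i"
        then have "?S \<subseteq> {..<i}" using initial[of i] that by (force simp: not_less le_less)
        then have "card ?S \<le> card {..<i}" by (intro card_mono) auto
        then show False using card_\<sigma> \<open>i < k\<close> by simp
      qed
    qed
  qed
  define P where "P = (\<lambda>i. v (2 * i)) ` {..<k}"
  define Q where "Q = (\<lambda>i. v (2 * i + 1)) ` {k..<n}"
  have P: "P \<subseteq> X" "card P = k"
    using even_zigzag[OF v(1)] k inX unfolding P_def bij_betw_def
    by (auto simp: card_image inj_on_subset)
  have "{k..<n} \<subseteq> {..<n}" by auto
  then have Q: "Q \<subseteq> Y" "card Q = n - k"
    using odd_zigzag[OF v(1)] k inY unfolding Q_def bij_betw_def
    by (auto simp: card_image inj_on_subset)
  have PQ: "(x, y) \<notin> E" if xy: "x \<in> P" "y \<in> Q" for x y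
  proof -
    obtain i j where i: "i < k" "x = v (2 * i)" and j: "k \<le> j" "j < n" "y = v (2 * j + 1)"
      using xy by (auto simp: P_def Q_def)
    then have "\<not> adj E x y" using inner[of j i] \<sigma>_iff k by auto
    then show ?thesis by (simp add: adj_def)
  qed
  have right: "{w \<in> X. (w, y) \<notin> E} = P" if y: "y \<in> Q" for y
  proof -
    have "P \<noteq> {}" using P k by auto
    then obtain x where "x \<in> P" by blast
    then have "deg E y = n - k" using tight PQ P Q y by blast
    moreover have "{w. adj E y w} = X - {w \<in> X. (w, y) \<notin> E}"
      using adj_sub_left[of y] y Q adj_iff[of _ y] adj_commute[of E y] by auto
    ultimately have "card (X - {w \<in> X. (w, y) \<notin> E}) = n - k" by (simp add: deg_def)
    moreover have "card (X - {w \<in> X. (w, y) \<notin> E}) = n - card {w \<in> X. (w, y) \<notin> E}"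
      using finite_X card_X by (subst card_Diff_subset) auto
    moreover have "card {w \<in> X. (w, y) \<notin> E} \<le> n"
      using finite_X card_X card_mono[of X "{w \<in> X. (w, y) \<notin> E}"] by auto
    ultimately have "card {w \<in> X. (w, y) \<notin> E} = k" using k by linarith
    then show ?thesis
      using P PQ y finite_X by (intro card_subset_eq[symmetric]) auto
  qed
  have left: "card {w \<in> Y. (x, w) \<notin> E} = n - k" if x: "x \<in> X" "y \<in> Y" "(x, y) \<notin> E" for x y
  proof -
    have "{w. adj E x w} = Y - {w \<in> Y. (x, w) \<notin> E}"
      using adj_sub_right[of x] x adj_iff[of x] by auto
    then have "k = card (Y - {w \<in> Y. (x, w) \<notin> E})" using tight[OF x] by (simp add: deg_def)
    moreover have "card (Y - {w \<in> Y. (x, w) \<notin> E}) = n - card {w \<in> Y. (x, w) \<notin> E}"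
      using finite_Y card_Y by (subst card_Diff_subset) auto
    ultimately show ?thesis using k by linarith
  qed
  have "x \<in> P \<and> y \<in> Q" if x: "x \<in> X" "y \<in> Y" "(x, y) \<notin> E" for x y
  proof -
    have "x \<in> P"
    proof (rule ccontr)
      assume "x \<notin> P"
      then have "{w \<in> Y. (x, w) \<notin> E} \<subseteq> Y - Q" using right x by blast
      then have "n - k \<le> card (Y - Q)"
        using left[OF x] finite_Y card_mono[of "Y - Q" "{w \<in> Y. (x, w) \<notin> E}"] by simp
      also have "card (Y - Q) = n - (n - k)"
        using Q finite_Y card_Y by (subst card_Diff_subset) (auto intro: finite_subset)
      finally show False using k by simp
    qed
    moreover have "Q = {w \<in> Y. (x, w) \<notin> E}"
      using left[OF x] Q PQ \<open>x \<in> P\<close> finite_Y by (intro card_subset_eq) auto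
    ultimately show ?thesis using x by blast
  qed
  then have "X \<times> Y - E = P \<times> Q" using PQ P Q by auto
  then show thesis using that P Q by blast
qed


lemma complete_hamiltonian:
  assumes "X \<times> Y \<subseteq> E" "n > 0"
  shows "hamiltonian E (X \<union> Y)"
proof -
  obtain p where p: "bij_betw p {0..<n} X"
    using ex_bij_betw_nat_finite[OF finite_X] card_X by auto
  obtain q where q: "bij_betw q {0..<n} Y"
    using ex_bij_betw_nat_finite[OF finite_Y] card_Y by auto
  define v where "v i = (if even i then p (i div 2) else q (i div 2))" for i
  have vX: "v i \<in> X" if "i < 2 * n" "even i" for i
    using that bij_betwE[OF p] by (auto simp: v_def)
  have vY: "v i \<in> Y" if "i < 2 * n" "odd i" for i
    using that bij_betwE[OF q] by (auto simp: v_def)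
  have "inj_on v {..<2 * n}"
  proof (rule inj_onI)
    fix i j assume ij: "i \<in> {..<2 * n}" "j \<in> {..<2 * n}" "v i = v j"
    have par: "even i \<longleftrightarrow> even j" using ij vX[of i] vX[of j] vY[of i] vY[of j] disjoint by auto
    have "i div 2 = j div 2"
    proof (cases "even i")
      case True
      then show ?thesis
        using ij par by (intro inj_onD[OF bij_betw_imp_inj_on[OF p]]) (auto simp: v_def)
    next
      case False
      then show ?thesis
        using ij par by (intro inj_onD[OF bij_betw_imp_inj_on[OF q]]) (auto simp: v_def)
    qed
    then show "i = j" using par by (metis even_iff_mod_2_eq_zero div_mult_mod_eq odd_iff_mod_2_eq_one)
  qed
  moreover have "v ` {..<2 * n} \<subseteq> X \<union> Y" using vX vY by auto
  moreover have "card (X \<union> Y) = 2 * n"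
    using finite_X finite_Y card_X card_Y disjoint by (simp add: card_Un_disjoint)
  ultimately have b: "bij_betw v {..<2 * n} (X \<union> Y)"
    using finite_X finite_Y by (simp add: bij_betw_def card_image card_subset_eq)
  have a: "adj E (v i) (v j)" if "i < 2 * n" "j < 2 * n" "even i \<noteq> even j" for i j
    using that vX[of i] vX[of j] vY[of i] vY[of j] assms by (auto simp: adj_def)
  show ?thesis
  proof (rule hamiltonian_reorderI[OF b])
    show "successively (\<lambda>i j. adj E (v i) (v j)) [0..<2 * n]"
      by (rule successively_upt) (auto intro: a)
    show "adj E (v (last [0..<2 * n])) (v (hd [0..<2 * n]))"
      using assms by (auto intro!: a)
  qed (use assms in auto)
qed

text \<open>
  A Hamiltonian cycle that exists only after \<open>xy\<close> is added has to use \<open>xy\<close>; cutting it there leaves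
  a Hamiltonian path of the original graph. For \<open>n = 1\<close> the closed walk \<open>[x, y]\<close> would use
  the same edge twice, hence the bound on \<open>n\<close>.
\<close>

lemma zigzag_of_added_edge:
  assumes nonham: "\<not> hamiltonian E (X \<union> Y)"
    and ham: "hamiltonian (insert (x, y) E) (X \<union> Y)"
    and xy: "x \<in> X" "y \<in> Y" and n: "n \<ge> 2"
  obtains v where "zigzag v" "v 0 = x" "v (2 * n - 1) = y"
proof -
  let ?V = "X \<union> Y" and ?E = "insert (x, y) E"
  have ins: "adj ?E u w \<longleftrightarrow> adj E u w \<or> u = x \<and> w = y \<or> u = y \<and> w = x" for u w
    by (auto simp: adj_def)
  obtain c0 where c0: "ham_cycle ?E ?V c0" using ham by (auto simp: hamiltonian_def)
  \<comment> \<open>rotate the cycle so that its closing edge is the new one, then orient it from \<open>x\<close> to \<open>y\<close>\<close>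
  have "\<exists>c. ham_cycle ?E ?V c \<and> \<not> adj E (last c) (hd c)"
  proof (cases "adj E (last c0) (hd c0)")
    case True
    then have "\<not> successively (adj E) c0"
      using nonham c0 by (auto simp: hamiltonian_def ham_cycle_def)
    then obtain i where i: "Suc i < length c0" "\<not> adj E (c0 ! i) (c0 ! Suc i)"
      by (auto simp: successively_conv_nth)
    let ?c = "drop (Suc i) c0 @ take (Suc i) c0"
    have "ham_cycle ?E ?V ?c"
      by (rule ham_cycle_append_commute) (use c0 in simp)
    moreover have "last ?c = c0 ! i" "hd ?c = c0 ! Suc i"
      using i by (auto simp: hd_drop_conv_nth take_Suc_conv_app_nth)
    ultimately show ?thesis using i by metis
  qed (use c0 in blast)
  then obtain c1 where c1: "ham_cycle ?E ?V c1" "\<not> adj E (last c1) (hd c1)" by blast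
  have "\<exists>c. ham_cycle ?E ?V c \<and> hd c = x \<and> last c = y"
  proof (cases "hd c1 = x")
    case True
    then show ?thesis using c1 ins xy disjoint by (auto simp: ham_cycle_def)
  next
    case False
    then have "hd c1 = y \<and> last c1 = x" using c1 ins by (auto simp: ham_cycle_def)
    then show ?thesis using ham_cycle_rev[OF c1(1)] by (metis hd_rev last_rev)
  qed
  then obtain c where c: "ham_cycle ?E ?V c" "hd c = x" "last c = y" by blast
  have dist: "distinct c" and set_c: "set c = ?V" and ne: "c \<noteq> []"
    using c by (auto simp: ham_cycle_def)
  have "length c = card ?V" using distinct_card[OF dist] set_c by simp
  also have "\<dots> = 2 * n"
    using finite_X finite_Y card_X card_Y disjoint by (simp add: card_Un_disjoint)
  finally have len: "length c = 2 * n" .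
  have ends: "c ! 0 = x" "c ! (2 * n - 1) = y"
    using c ne len by (auto simp: hd_conv_nth last_conv_nth)
  have step: "adj E (c ! i) (c ! Suc i)" if i: "Suc i < 2 * n" for i
  proof (rule ccontr)
    assume "\<not> adj E (c ! i) (c ! Suc i)"
    moreover have "adj ?E (c ! i) (c ! Suc i)"
      using c(1) len i by (auto simp: ham_cycle_def successively_conv_nth)
    ultimately consider "c ! i = x" "c ! Suc i = y" | "c ! i = y" "c ! Suc i = x"
      using ins by blast
    then show False
    proof cases
      case 1
      then have "i = 0" "Suc i = 2 * n - 1"
        using nth_eq_iff_index_eq[OF dist, of i 0] nth_eq_iff_index_eq[OF dist, of "Suc i" "2 * n - 1"]
          ends len i by auto
      then show False using n by simp
    next
      case 2
      then show False using nth_eq_iff_index_eq[OF dist, of "Suc i" 0] ends len i by auto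
    qed
  qed
  have par: "c ! i \<in> (if even i then X else Y)" if "i < 2 * n" for i
    using that
  proof (induction i)
    case 0
    then show ?case using ends xy by simp
  next
    case (Suc i)
    then show ?case
      using step[of i] adj_sub_right[of "c ! i" "c ! Suc i"] adj_sub_left[of "c ! i" "c ! Suc i"]
      by (auto split: if_splits)
  qed
  have "zigzag ((!) c)"
    unfolding zigzag_def
  proof (intro conjI allI impI)
    show "bij_betw ((!) c) {..<2 * n} ?V"
      using dist len set_c by (intro bij_betw_nth) auto
  next
    fix i assume "i < n"
    then show "c ! (2 * i) \<in> X" "c ! (2 * i + 1) \<in> Y"
      using par[of "2 * i"] par[of "2 * i + 1"] by auto
  qed (rule step)
  then show thesis using that ends by blast
qed

lemma deg_complement:
  assumes "u \<in> X \<union> Y"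
  shows "deg (X \<times> Y - E) u + deg E u = n"
proof -
  define S where "S = (if u \<in> X then Y else X)"
  have "{w. adj (X \<times> Y - E) u w} = S - {w. adj E u w}" and sub: "{w. adj E u w} \<subseteq> S"
    using assms disjoint E_sub by (auto simp: adj_def S_def)
  moreover have "finite S" "card S = n"
    using finite_X finite_Y card_X card_Y by (auto simp: S_def)
  ultimately show ?thesis
    using card_mono[OF _ sub] by (simp add: deg_def card_Diff_subset finite_subset)
qed

end

lemma maximal_nonhamiltonian_extension:
  assumes "balanced_bipartite X Y E n" "\<not> hamiltonian E (X \<union> Y)"
  obtains F where "E \<subseteq> F" "balanced_bipartite X Y F n" "\<not> hamiltonian F (X \<union> Y)"
    and "\<And>x y. x \<in> X \<Longrightarrow> y \<in> Y \<Longrightarrow> (x, y) \<notin> F \<Longrightarrow> hamiltonian (insert (x, y) F) (X \<union> Y)"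
proof -
  interpret balanced_bipartite X Y E n by fact
  let ?A = "{F. F \<subseteq> X \<times> Y \<and> \<not> hamiltonian F (X \<union> Y)}"
  have "finite ?A"
    using finite_X finite_Y by (intro finite_subset[of ?A "Pow (X \<times> Y)"]) auto
  moreover have "E \<in> ?A" using assms(2) E_sub by simp
  ultimately have "\<exists>F\<in>?A. E \<subseteq> F \<and> (\<forall>F'\<in>?A. F \<subseteq> F' \<longrightarrow> F = F')"
    by (rule finite_has_maximal2)
  then obtain F where F: "F \<subseteq> X \<times> Y" "\<not> hamiltonian F (X \<union> Y)" "E \<subseteq> F"
    and max: "\<forall>F'\<in>?A. F \<subseteq> F' \<longrightarrow> F = F'" by auto
  show thesis
  proof (rule that[of F])
    show "balanced_bipartite X Y F n"
      using F finite_X finite_Y card_X card_Y disjoint by unfold_locales auto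
    show "hamiltonian (insert (x, y) F) (X \<union> Y)" if "x \<in> X" "y \<in> Y" "(x, y) \<notin> F" for x y
    proof (rule ccontr)
      assume "\<not> hamiltonian (insert (x, y) F) (X \<union> Y)"
      then have "F = insert (x, y) F" using bspec[OF max, of "insert (x, y) F"] that F by auto
      then show False using that by blast
    qed
  qed (use F in auto)
qed

section \<open>The Rayleigh quotient and its equality case\<close>

text \<open>
  Extending by \<open>0\<close> outside \<open>V\<close> makes the unit sphere a closed subset of a product of compact
  intervals, so Tychonoff's theorem applies without a type for the dimension.
\<close>

lemma compact_unit_sphere_fun:
  fixes V :: "'a set"
  assumes "finite V"
  shows "compact {f :: 'a \<Rightarrow> real. (\<forall>u. u \<notin> V \<longrightarrow> f u = 0) \<and> (\<Sum>u\<in>V. (f u)\<^sup>2) = 1}"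
    (is "compact ?S")
proof -
  define B where "B u = (if u \<in> V then {-1..1} else {0 :: real})" for u
  have "compactin (product_topology (\<lambda>_. euclidean) UNIV) (PiE UNIV B)"
    unfolding compactin_PiE by (auto simp: B_def)
  then have "compact (PiE UNIV B)"
    by (simp add: euclidean_product_topology)
  moreover have "closed {f :: 'a \<Rightarrow> real. (\<Sum>u\<in>V. (f u)\<^sup>2) = 1}"
    by (intro closed_Collect_eq continuous_intros continuous_on_product_coordinates)
  ultimately have "compact (PiE UNIV B \<inter> {f. (\<Sum>u\<in>V. (f u)\<^sup>2) = 1})"
    by (rule compact_Int_closed)
  moreover have "?S = PiE UNIV B \<inter> {f. (\<Sum>u\<in>V. (f u)\<^sup>2) = 1}"
  proof (intro equalityI subsetI)
    fix f assume f: "f \<in> ?S"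
    have "\<bar>f u\<bar> \<le> 1" if "u \<in> V" for u
      using member_le_sum[OF that, of "\<lambda>u. (f u)\<^sup>2"] f assms by (simp add: abs_square_le_1)
    then show "f \<in> PiE UNIV B \<inter> {f. (\<Sum>u\<in>V. (f u)\<^sup>2) = 1}"
      using f by (auto simp: B_def PiE_def Pi_def abs_le_iff)
  qed (auto simp: B_def PiE_def Pi_def split: if_splits)
  ultimately show ?thesis by simp
qed

text \<open>
  A zero \<open>g\<close> of a nonnegative quadratic form is a minimum, so the derivative in every direction
  vanishes. Here this is seen by moving \<open>g\<close> by \<open>t\<close> in the coordinate \<open>z\<close>: the form changes by
  a quadratic polynomial in \<open>t\<close> without constant term, which can only be nonnegative if its
  linear coefficient is \<open>0\<close>.
\<close>

lemma null_vector_of_semidefinite: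
  fixes a :: "'a \<Rightarrow> 'a \<Rightarrow> real"
  assumes fin: "finite V" and sym: "\<And>u w. u \<in> V \<Longrightarrow> w \<in> V \<Longrightarrow> a u w = a w u"
    and semidef: "\<And>f. 0 \<le> (\<Sum>u\<in>V. \<Sum>w\<in>V. a u w * f u * f w)"
    and null: "(\<Sum>u\<in>V. \<Sum>w\<in>V. a u w * g u * g w) \<le> 0" and z: "z \<in> V"
  shows "(\<Sum>w\<in>V. a z w * g w) = 0"
proof -
  define b where "b = (\<Sum>w\<in>V. a z w * g w)"
  have "0 \<le> 2 * b * t + a z z * t\<^sup>2" for t
  proof -
    define f where "f u = g u + (if u = z then t else 0)" for u
    have "(\<Sum>u\<in>V. \<Sum>w\<in>V. a u w * f u * f w)
      = (\<Sum>u\<in>V. \<Sum>w\<in>V. a u w * g u * g w)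
        + (\<Sum>u\<in>V. \<Sum>w\<in>V. (if w = z then a u w * g u * t else 0))
        + (\<Sum>u\<in>V. \<Sum>w\<in>V. (if u = z then a u w * t * g w else 0))
        + (\<Sum>u\<in>V. \<Sum>w\<in>V. (if w = z then if u = z then a u w * t * t else 0 else 0))"
      unfolding sum.distrib[symmetric] f_def
      by (intro sum.cong refl) (simp add: algebra_simps)
    also have "(\<Sum>u\<in>V. \<Sum>w\<in>V. (if w = z then a u w * g u * t else 0)) = b * t"
      using fin z sym by (simp add: b_def sum_distrib_right)
    also have "(\<Sum>u\<in>V. \<Sum>w\<in>V. (if u = z then a u w * t * g w else 0)) = b * t"
      using fin z by (subst sum.swap) (simp add: b_def sum_distrib_left mult_ac)
    also have "(\<Sum>u\<in>V. \<Sum>w\<in>V. (if w = z then if u = z then a u w * t * t else 0 else 0))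
        = a z z * t\<^sup>2"
      using fin z by (simp add: power2_eq_square mult_ac)
    finally show ?thesis using semidef[of f] null by (simp add: mult_ac)
  qed
  note nonneg = this
  have "b = 0"
  proof (rule ccontr)
    assume "b \<noteq> 0"
    \<comment> \<open>any \<open>s > a z z\<close> makes the step \<open>- b / s\<close> short enough for the linear term to win\<close>
    define s where "s = \<bar>a z z\<bar> + 1"
    have s: "s > 0" "a z z < s" by (auto simp: s_def)
    have "0 \<le> 2 * b * (- b / s) + a z z * (- b / s)\<^sup>2" by (rule nonneg)
    also have "\<dots> = (b / s)\<^sup>2 * (a z z - 2 * s)"
      using s by (simp add: power2_eq_square field_simps)
    also have "\<dots> < 0"
      using s \<open>b \<noteq> 0\<close> by (intro mult_pos_neg) (auto simp: zero_less_power2)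
    finally show False by simp
  qed
  then show ?thesis by (simp add: b_def)
qed

text \<open>
  A maximiser \<open>g\<close> of the form on the compact unit sphere, with maximum \<open>M\<close>, is a null vector of the
  semidefinite form \<open>M * |f|\<^sup>2 - q f\<close>, hence an eigenvector.
\<close>

lemma quadratic_form_has_max_eigenvalue:
  fixes a :: "'a \<Rightarrow> 'a \<Rightarrow> real"
  assumes fin: "finite V" and ne: "V \<noteq> {}"
    and sym: "\<And>u w. u \<in> V \<Longrightarrow> w \<in> V \<Longrightarrow> a u w = a w u"
  obtains M g where "\<exists>u\<in>V. g u \<noteq> 0" "\<And>u. u \<in> V \<Longrightarrow> (\<Sum>w\<in>V. a u w * g w) = M * g u"
    and "\<And>f. (\<Sum>u\<in>V. \<Sum>w\<in>V. a u w * f u * f w) \<le> M * (\<Sum>u\<in>V. (f u)\<^sup>2)"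
proof -
  define S where "S = {f :: 'a \<Rightarrow> real. (\<forall>u. u \<notin> V \<longrightarrow> f u = 0) \<and> (\<Sum>u\<in>V. (f u)\<^sup>2) = 1}"
  define q where "q f = (\<Sum>u\<in>V. \<Sum>w\<in>V. a u w * f u * f w)" for f
  obtain v where "v \<in> V" using ne by blast
  have "(\<Sum>u\<in>V. (if u = v then 1 else 0 :: real)\<^sup>2) = (\<Sum>u\<in>V. if u = v then 1 else 0)"
    by (intro sum.cong) auto
  then have "(\<lambda>u. if u = v then 1 else 0) \<in> S"
    using fin \<open>v \<in> V\<close> by (simp add: S_def)
  moreover have "compact S" unfolding S_def by (rule compact_unit_sphere_fun[OF fin])
  moreover have "continuous_on S q"
    unfolding q_def by (intro continuous_intros continuous_on_subset[OF continuous_on_product_coordinates]) auto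
  ultimately obtain g where g: "g \<in> S" "\<And>f. f \<in> S \<Longrightarrow> q f \<le> q g"
    using continuous_attains_sup[of S q] by blast
  have bound: "q f \<le> q g * (\<Sum>u\<in>V. (f u)\<^sup>2)" for f
  proof (cases "(\<Sum>u\<in>V. (f u)\<^sup>2) = 0")
    case True
    then have "\<And>u. u \<in> V \<Longrightarrow> f u = 0"
      using fin by (simp add: sum_nonneg_eq_0_iff)
    then show ?thesis by (simp add: q_def)
  next
    case False
    define r where "r = (\<Sum>u\<in>V. (f u)\<^sup>2)"
    have "r > 0" using False by (simp add: r_def less_le sum_nonneg)
    define h where "h u = (if u \<in> V then f u / sqrt r else 0)" for u
    have h2: "(\<Sum>u\<in>V. (h u)\<^sup>2) = 1"
      using \<open>r > 0\<close> by (simp add: h_def power_divide flip: sum_divide_distrib r_def)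
    have "q h = (\<Sum>u\<in>V. \<Sum>w\<in>V. (a u w * f u * f w) / r)"
      unfolding q_def using \<open>r > 0\<close>
      by (intro sum.cong refl) (simp add: h_def flip: real_sqrt_mult_self power2_eq_square)
    then have "q h = q f / r" by (simp add: q_def flip: sum_divide_distrib)
    moreover have "q h \<le> q g" using h2 by (intro g) (simp add: S_def h_def)
    ultimately show ?thesis using \<open>r > 0\<close> by (simp add: pos_divide_le_eq flip: r_def)
  qed
  have form: "(\<Sum>u\<in>V. \<Sum>w\<in>V. ((if u = w then q g else 0) - a u w) * f u * f w)
      = q g * (\<Sum>u\<in>V. (f u)\<^sup>2) - q f" for f
  proof -
    have "(\<Sum>u\<in>V. \<Sum>w\<in>V. ((if u = w then q g else 0) - a u w) * f u * f w)
      = (\<Sum>u\<in>V. \<Sum>w\<in>V. (if u = w then q g * (f u)\<^sup>2 else 0) - a u w * f u * f w)"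
      by (intro sum.cong refl) (simp add: algebra_simps power2_eq_square)
    then show ?thesis using fin by (simp add: sum_subtractf q_def sum_distrib_left)
  qed
  have "(\<Sum>w\<in>V. a u w * g w) = q g * g u" if u: "u \<in> V" for u
  proof -
    have "(\<Sum>w\<in>V. ((if u = w then q g else 0) - a u w) * g w) = 0"
    proof (rule null_vector_of_semidefinite[OF fin _ _ _ u])
      show "0 \<le> (\<Sum>u\<in>V. \<Sum>w\<in>V. ((if u = w then q g else 0) - a u w) * f u * f w)" for f
        unfolding form using bound[of f] by simp
      show "(\<Sum>u\<in>V. \<Sum>w\<in>V. ((if u = w then q g else 0) - a u w) * g u * g w) \<le> 0"
        unfolding form using g(1) by (simp add: S_def)
    qed (use sym in auto)
    moreover have "(\<Sum>w\<in>V. ((if u = w then q g else 0) - a u w) * g w)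
      = (\<Sum>w\<in>V. (if u = w then q g * g w else 0) - a u w * g w)"
      by (intro sum.cong refl) (simp add: algebra_simps)
    ultimately show ?thesis using fin u by (simp add: sum_subtractf)
  qed
  moreover have "\<exists>u\<in>V. g u \<noteq> 0"
  proof (rule ccontr)
    assume "\<not> ?thesis"
    then have "(\<Sum>u\<in>V. (g u)\<^sup>2) = 0" by simp
    then show False using g(1) by (simp add: S_def)
  qed
  ultimately show thesis using that bound unfolding q_def by blast
qed

definition adj_entry :: "('a, 'b) pre_digraph \<Rightarrow> 'a \<Rightarrow> 'a \<Rightarrow> real" where
  "adj_entry G u w = (if (u, w) \<in> arcs_ends G then 1 else 0)"

lemma eigenvalue_le_spectral_rad:
  assumes fin: "finite (verts G)" and g: "\<exists>u\<in>verts G. g u \<noteq> 0"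
    and eig: "\<And>u. u \<in> verts G \<Longrightarrow> (\<Sum>w\<in>verts G. adj_entry G u w * g w) = M * g u"
  shows "M \<le> spectral_rad G"
proof -
  define vs where "vs = (SOME vs. distinct vs \<and> set vs = verts G)"
  have vs: "distinct vs" "set vs = verts G"
    using someI_ex[of "\<lambda>vs. distinct vs \<and> set vs = verts G"] finite_distinct_list[OF fin]
    unfolding vs_def by blast+
  define n where "n = length vs"
  define A where "A = adj_matrix G vs"
  define x where "x = vec n (\<lambda>i. g (vs ! i))"
  have A: "A \<in> carrier_mat n n" by (simp add: A_def adj_matrix_def n_def)
  have "eigenvector A x M"
    unfolding eigenvector_def
  proof (intro conjI)
    show "x \<in> carrier_vec (dim_row A)" using A by (simp add: x_def)
    obtain u where "u \<in> set vs" "g u \<noteq> 0" using g vs(2) by blast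
    then obtain i where "i < n" "g (vs ! i) \<noteq> 0" by (auto simp: in_set_conv_nth n_def)
    then have "x $ i \<noteq> 0\<^sub>v n $ i" by (simp add: x_def)
    moreover have "dim_row A = n" using A by simp
    ultimately show "x \<noteq> 0\<^sub>v (dim_row A)" by metis
    show "A *\<^sub>v x = M \<cdot>\<^sub>v x"
    proof (rule eq_vecI)
      fix i assume "i < dim_vec (M \<cdot>\<^sub>v x)"
      then have i: "i < n" by (simp add: x_def)
      have "(A *\<^sub>v x) $ i = row A i \<bullet> x" using i A by (intro index_mult_mat_vec) simp
      also have "\<dots> = (\<Sum>j = 0..<n. row A i $ j * x $ j)" by (simp only: scalar_prod_def x_def dim_vec)
      also have "\<dots> = (\<Sum>j = 0..<n. adj_entry G (vs ! i) (vs ! j) * g (vs ! j))"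
      proof (rule sum.cong[OF refl])
        fix j assume "j \<in> {0..<n}"
        then have j: "j < n" by simp
        have "row A i $ j = A $$ (i, j)" using i j A by (intro index_row) auto
        also have "\<dots> = adj_entry G (vs ! i) (vs ! j)"
          using i j unfolding A_def adj_matrix_def adj_entry_def n_def by (subst index_mat) auto
        finally show "row A i $ j * x $ j = adj_entry G (vs ! i) (vs ! j) * g (vs ! j)"
          using j by (simp only: x_def index_vec)
      qed
      also have "\<dots> = (\<Sum>w\<in>verts G. adj_entry G (vs ! i) w * g w)"
        by (rule sum.reindex_bij_betw, rule bij_betw_nth) (use vs in \<open>auto simp: n_def\<close>)
      also have "\<dots> = M * g (vs ! i)" using i vs by (intro eig) (metis n_def nth_mem)
      finally show "(A *\<^sub>v x) $ i = (M \<cdot>\<^sub>v x) $ i" using i by (simp add: x_def)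
    qed (use A in \<open>simp add: x_def\<close>)
  qed
  then have "M \<in> spectrum A" by (auto simp: spectrum_def eigenvalue_def)
  then show ?thesis
    unfolding spectral_rad_def vs_def[symmetric] A_def[symmetric]
    using card_finite_spectrum(1)[OF A] by (rule Max_ge[rotated])
qed

text \<open>
  The spectral radius dominates the maximal Rayleigh quotient, so a vector whose quotient reaches an
  upper bound \<open>c\<close> of the spectral radius is a null vector of the semidefinite form
  \<open>c * |f|\<^sup>2 - q f\<close>.
\<close>

lemma rayleigh_equality:
  assumes fin: "finite (verts G)" and sym: "symmetric G"
    and c: "spectral_rad G \<le> c"
    and f: "c * (\<Sum>u\<in>verts G. (f u)\<^sup>2)
      \<le> (\<Sum>u\<in>verts G. \<Sum>w\<in>verts G. adj_entry G u w * f u * f w)"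
    and u: "u \<in> verts G"
  shows "(\<Sum>w\<in>verts G. adj_entry G u w * f w) = c * f u"
proof -
  let ?V = "verts G" and ?a = "adj_entry G"
  have a: "?a u w = ?a w u" for u w
    using sym by (auto simp: adj_entry_def symmetric_def dest: symD)
  have ne: "?V \<noteq> {}" using u by blast
  obtain M g where g: "\<exists>u\<in>?V. g u \<noteq> 0" "\<And>u. u \<in> ?V \<Longrightarrow> (\<Sum>w\<in>?V. ?a u w * g w) = M * g u"
    and M: "\<And>f. (\<Sum>u\<in>?V. \<Sum>w\<in>?V. ?a u w * f u * f w) \<le> M * (\<Sum>u\<in>?V. (f u)\<^sup>2)"
    by (rule quadratic_form_has_max_eigenvalue[OF fin ne a]) (rule that)
  have Mc: "M \<le> c" using eigenvalue_le_spectral_rad[OF fin g] c by simp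
  have form: "(\<Sum>u\<in>?V. \<Sum>w\<in>?V. ((if u = w then c else 0) - ?a u w) * f u * f w)
      = c * (\<Sum>u\<in>?V. (f u)\<^sup>2) - (\<Sum>u\<in>?V. \<Sum>w\<in>?V. ?a u w * f u * f w)" for f
  proof -
    have "(\<Sum>u\<in>?V. \<Sum>w\<in>?V. ((if u = w then c else 0) - ?a u w) * f u * f w)
      = (\<Sum>u\<in>?V. \<Sum>w\<in>?V. (if u = w then c * (f u)\<^sup>2 else 0) - ?a u w * f u * f w)"
      by (intro sum.cong refl) (simp add: algebra_simps power2_eq_square)
    then show ?thesis using fin by (simp add: sum_subtractf sum_distrib_left)
  qed
  have "(\<Sum>w\<in>?V. ((if u = w then c else 0) - ?a u w) * f w) = 0"
  proof (rule null_vector_of_semidefinite[OF fin _ _ _ u])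
    show "0 \<le> (\<Sum>u\<in>?V. \<Sum>w\<in>?V. ((if u = w then c else 0) - ?a u w) * f u * f w)" for f
      unfolding form using M[of f] mult_right_mono[OF Mc, of "\<Sum>u\<in>?V. (f u)\<^sup>2"]
      by (simp add: sum_nonneg)
    show "(\<Sum>u\<in>?V. \<Sum>w\<in>?V. ((if u = w then c else 0) - ?a u w) * f u * f w) \<le> 0"
      unfolding form using f by simp
  qed (use a in auto)
  moreover have "(\<Sum>w\<in>?V. ((if u = w then c else 0) - ?a u w) * f w)
    = (\<Sum>w\<in>?V. (if u = w then c * f w else 0) - ?a u w * f w)"
    by (intro sum.cong refl) (simp add: algebra_simps)
  ultimately show ?thesis using fin u by (simp add: sum_subtractf)
qed

lemma arcs_ends_graph_of: "(u, w) \<in> arcs_ends (graph_of B) \<longleftrightarrow> adj (bedges B) u w"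
  by (auto simp: graph_of_def adj_def)

lemma verts_graph_of: "verts (graph_of B) = lpart B \<union> rpart B"
  by (simp add: graph_of_def)

lemma out_degree_graph_of: "out_degree (graph_of B) u = deg (bedges B) u"
proof -
  have "out_arcs (graph_of B) u = Pair u ` {w. adj (bedges B) u w}"
    by (auto simp: out_arcs_def graph_of_def adj_def)
  then show ?thesis by (simp add: out_degree_def deg_def card_image inj_on_def)
qed

text \<open>
  With the test vector \<open>f u = sqrt (deg N u)\<close>, both \<open>c * |f|\<^sup>2\<close> and the adjacency form are sums over
  ordered pairs, and \<open>c * |f|\<^sup>2\<close> is smaller termwise: a pair adjacent in \<open>N\<close> contributes \<open>c\<close> to the
  one and \<open>f u * f w \<ge> c\<close> to the other. So \<open>f\<close> is an eigenvector for \<open>c\<close>. Its eigenvalue equation at a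
  vertex of \<open>N\<close> turns the termwise inequalities there into equalities, and at a vertex outside \<open>N\<close> it
  says that \<open>f\<close> vanishes on all neighbours.
\<close>

lemma spectral_equality:
  assumes B: "bipartite_graph B" and N: "N \<subseteq> bedges B"
    and c: "spectral_rad (graph_of B) \<le> c" "0 < c"
    and prod: "\<And>x y. (x, y) \<in> N \<Longrightarrow> c\<^sup>2 \<le> real (deg N x) * real (deg N y)"
  shows "(x, y) \<in> N \<Longrightarrow> real (deg N x) * real (deg N y) = c\<^sup>2"
    and "(x, y) \<in> bedges B \<Longrightarrow> deg N x = 0 \<longleftrightarrow> deg N y = 0"
proof -
  define V where "V = lpart B \<union> rpart B"
  have fin: "finite V" using B by (simp add: V_def bipartite_graph_def)
  have V: "verts (graph_of B) = V" by (simp add: V_def verts_graph_of)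
  define m where "m u w = (if adj (bedges B) u w then 1 else 0 :: real)" for u w
  define a where "a u w = (if adj N u w then 1 else 0 :: real)" for u w
  define f where "f u = sqrt (real (deg N u))" for u
  have entry: "adj_entry (graph_of B) = m"
    by (simp add: fun_eq_iff adj_entry_def m_def arcs_ends_graph_of)
  have sym: "symmetric (graph_of B)"
    by (auto simp: symmetric_def sym_def arcs_ends_graph_of adj_def)
  have am: "a u w \<le> m u w" for u w using N by (auto simp: a_def m_def adj_def)
  have inV: "w \<in> V" if "adj (bedges B) u w" for u w
    using that B by (auto simp: adj_def V_def bipartite_graph_def)
  have adjN: "adj (bedges B) u w" if "adj N u w" for u w using that N by (auto simp: adj_def)
  have deg_sum: "real (deg N u) = (\<Sum>w\<in>V. a u w)" for u
  proof -
    have "{w. adj N u w} = {w \<in> V. adj N u w}" using inV adjN by blast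
    then show ?thesis using fin by (simp add: deg_def a_def sum.If_cases Int_def)
  qed
  have f2: "(f u)\<^sup>2 = real (deg N u)" for u by (simp add: f_def)
  have f_nonneg: "0 \<le> f u" for u by (simp add: f_def)
  have edge: "c \<le> f u * f w" if "adj N u w" for u w
  proof -
    have "c\<^sup>2 \<le> real (deg N u) * real (deg N w)"
      using that prod[of u w] prod[of w u] by (auto simp: adj_def mult.commute)
    then have "sqrt (c\<^sup>2) \<le> sqrt (real (deg N u) * real (deg N w))" by (rule real_sqrt_le_mono)
    then show ?thesis using c by (simp add: f_def real_sqrt_mult)
  qed
  have termwise: "c * a u w \<le> m u w * f u * f w" for u w
    using edge[of u w] adjN[of u w] f_nonneg by (auto simp: a_def m_def)
  have "c * (\<Sum>u\<in>V. (f u)\<^sup>2) = (\<Sum>u\<in>V. \<Sum>w\<in>V. c * a u w)"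
    by (simp add: f2 deg_sum sum_distrib_left)
  also have "\<dots> \<le> (\<Sum>u\<in>V. \<Sum>w\<in>V. m u w * f u * f w)"
    by (intro sum_mono termwise)
  finally have eig: "(\<Sum>w\<in>V. m u w * f w) = c * f u" if "u \<in> V" for u
    using rayleigh_equality[OF _ sym c(1), of f u] fin that by (simp add: V entry)
  have eq: "f u * f w = c" if uw: "adj N u w" for u w
  proof -
    have u: "u \<in> V" and w: "w \<in> V"
      using inV[of u w] inV[of w u] adjN[OF uw] adj_commute[of _ u w] by simp_all
    have "(\<Sum>w\<in>V. m u w * f u * f w) = f u * (\<Sum>w\<in>V. m u w * f w)"
      by (simp add: sum_distrib_left mult_ac)
    also have "\<dots> = c * (f u)\<^sup>2" using eig[OF u] by (simp add: power2_eq_square)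
    also have "\<dots> = (\<Sum>w\<in>V. c * a u w)" by (simp add: f2 deg_sum sum_distrib_left)
    finally have "(\<Sum>w\<in>V. m u w * f u * f w - c * a u w) = 0" by (simp add: sum_subtractf)
    then have "\<forall>w\<in>V. m u w * f u * f w - c * a u w = 0"
      using fin termwise by (subst (asm) sum_nonneg_eq_0_iff) auto
    then have "m u w * f u * f w - c * a u w = 0" using w by blast
    then show ?thesis using uw adjN[OF uw] by (simp add: a_def m_def)
  qed
  have iso: "deg N w = 0" if uw: "adj (bedges B) u w" and z: "deg N u = 0" for u w
  proof -
    have u: "u \<in> V" and w: "w \<in> V"
      using inV[of u w] inV[of w u] uw adj_commute[of _ u w] by simp_all
    have "(\<Sum>w\<in>V. m u w * f w) = 0" using eig[OF u] z by (simp add: f_def)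
    moreover have "0 \<le> m u w * f w" for w using f_nonneg by (simp add: m_def)
    ultimately have "\<forall>w\<in>V. m u w * f w = 0"
      using fin by (subst (asm) sum_nonneg_eq_0_iff) auto
    then have "m u w * f w = 0" using w by blast
    then show ?thesis using uw by (simp add: m_def f_def)
  qed
  show "real (deg N x) * real (deg N y) = c\<^sup>2" if "(x, y) \<in> N"
  proof -
    have "f x * f y = c" using that by (intro eq) (simp add: adj_def)
    then have "(f x)\<^sup>2 * (f y)\<^sup>2 = c\<^sup>2" by (simp flip: power_mult_distrib)
    then show ?thesis by (simp add: f2)
  qed
  show "deg N x = 0 \<longleftrightarrow> deg N y = 0" if "(x, y) \<in> bedges B"
    using iso[of x y] iso[of y x] that by (auto simp: adj_def)
qed

section \<open>Degrees in the complement of the maximal graph\<close>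

text \<open>
  Put \<open>a = n - k - \<alpha>\<close> and \<open>b = k + \<beta>\<close>. Then \<open>0 \<le> \<alpha> \<le> \<beta> < n - 2 * k\<close>, and \<open>a * b\<close> exceeds
  \<open>k * (n - k)\<close> by at least \<open>\<beta> * (n - 2 * k - \<beta>) \<ge> \<beta>\<close>. The strictness of the bound on \<open>b\<close> comes
  from the universal vertex and is what excludes the second solution \<open>a = k\<close>, \<open>b = n - k\<close>.
\<close>

lemma degree_product_bound:
  fixes a b k n :: nat
  assumes "a + k \<le> n" "b + k < n" "n \<le> a + b"
  shows "k * (n - k) \<le> a * b"
    and "a * b = k * (n - k) \<Longrightarrow> a = n - k \<and> b = k"
proof -
  define \<alpha> \<beta> where "\<alpha> = int n - int k - int a" and "\<beta> = int b - int k"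
  have le: "0 \<le> \<alpha>" "\<alpha> \<le> \<beta>" "\<beta> + 2 * int k + 1 \<le> int n"
    using assms by (auto simp: \<alpha>_def \<beta>_def)
  have ab: "int a = int n - int k - \<alpha>" "int b = int k + \<beta>" by (simp_all add: \<alpha>_def \<beta>_def)
  have "k \<le> n" using assms by simp
  then have kn: "int (k * (n - k)) = int k * (int n - int k)" by (simp only: of_nat_mult of_nat_diff)
  have "int (a * b) - int (k * (n - k)) = \<beta> * (int n - int k - \<alpha>) - \<alpha> * int k"
    unfolding kn unfolding of_nat_mult ab by (simp add: algebra_simps)
  moreover have "\<beta> * (int n - int k - \<beta>) \<le> \<beta> * (int n - int k - \<alpha>)" "\<alpha> * int k \<le> \<beta> * int k"
    using le by (auto intro: mult_left_mono mult_right_mono)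
  moreover have "\<beta> * 1 \<le> \<beta> * (int n - 2 * int k - \<beta>)"
    using le by (intro mult_left_mono) auto
  ultimately have *: "\<beta> \<le> int (a * b) - int (k * (n - k))" by (simp add: algebra_simps)
  then have "int (k * (n - k)) \<le> int (a * b)" using le by linarith
  then show "k * (n - k) \<le> a * b" by (simp only: of_nat_le_iff)
  assume "a * b = k * (n - k)"
  then have "\<beta> = 0" "\<alpha> = 0" using * le by auto
  then show "a = n - k \<and> b = k" using ab assms by auto
qed

section \<open>Recognising the exceptional family\<close>

lemma digraph_iso_graph_of:
  assumes B: "bipartite_graph B" and g: "inj_on g (lpart B \<union> rpart B)"
    and "lpart H \<union> rpart H = g ` (lpart B \<union> rpart B)"
    and "bedges H = map_prod g g ` bedges B"
  shows "digraph_iso (graph_of B) (graph_of H)"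
proof -
  let ?f = "\<lparr>iso_verts = g, iso_arcs = map_prod g g, iso_head = snd, iso_tail = fst\<rparr>"
  interpret graph "graph_of B" by (rule graph_graph_of[OF B])
  have sub: "arcs (graph_of B) \<subseteq> (lpart B \<union> rpart B) \<times> (lpart B \<union> rpart B)"
    using B by (auto simp: graph_of_def bipartite_graph_def)
  have "inj_on (map_prod g g) (arcs (graph_of B))"
    by (rule inj_on_subset[OF map_prod_inj_on[OF g g] sub])
  then have "digraph_isomorphism ?f"
    unfolding digraph_isomorphism_def using g wf_digraph_axioms by (auto simp: graph_of_def)
  moreover have "graph_of H = app_iso ?f (graph_of B)"
    using assms(3,4) by (auto simp: graph_of_def app_iso_def with_proj_def image_Un converse_def)
  ultimately show ?thesis by (auto simp: digraph_iso_def)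
qed

text \<open>
  The set \<open>P \<union> Q\<close> is mapped to the edgeless summand, whose parts have sizes \<open>j\<close> and \<open>n - j\<close>, and the
  rest of the graph to the arbitrary summand.
\<close>

lemma C_family_iso:
  assumes B: "bipartite_graph B" and cards: "card (lpart B) = n - 1" "card (rpart B) = n"
    and P: "P \<subseteq> lpart B" "card P = j" and Q: "Q \<subseteq> rpart B" "card Q = n - j" and j: "j \<le> n"
    and none: "bedges B \<inter> P \<times> Q = {}"
    and full: "P \<times> (rpart B - Q) \<subseteq> bedges B" "(lpart B - P) \<times> Q \<subseteq> bedges B"
  shows "\<exists>H \<in> C_family n j. digraph_iso (graph_of B) (graph_of H)"
proof -
  let ?X = "lpart B" and ?Y = "rpart B"
  have fin: "finite ?X" "finite ?Y" and dis: "?X \<inter> ?Y = {}" and E: "bedges B \<subseteq> ?X \<times> ?Y"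
    using B by (auto simp: bipartite_graph_def)
  have finPQ: "finite P" "finite Q" using fin P Q finite_subset by blast+
  have cX: "card (?X - P) = n - j - 1" and cY: "card (?Y - Q) = j"
    using cards P Q j finPQ by (auto simp: card_Diff_subset)
  obtain p where p: "bij_betw p P {0..<j}"
    using finite_same_card_bij[OF finPQ(1), of "{0..<j}"] P by auto
  obtain q where q: "bij_betw q Q {j..<j + (n - j)}"
    using finite_same_card_bij[OF finPQ(2), of "{j..<j + (n - j)}"] Q by auto
  obtain r where r: "bij_betw r (?X - P) {0..<n - j - 1}"
    using finite_same_card_bij[of "?X - P" "{0..<n - j - 1}"] fin cX by auto
  obtain s where s: "bij_betw s (?Y - Q) {n - j - 1..<n - j - 1 + j}"
    using finite_same_card_bij[of "?Y - Q" "{n - j - 1..<n - j - 1 + j}"] fin cY by auto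
  define g where "g u = (if u \<in> P then Inl (p u) else if u \<in> Q then Inl (q u)
    else if u \<in> ?X then Inr (r u) else Inr (s u))" for u
  define G0 where "G0 = \<lparr>lpart = {0..<n - j - 1}, rpart = {n - j - 1..<n - j - 1 + j},
    bedges = map_prod r s ` (bedges B \<inter> (?X - P) \<times> (?Y - Q))\<rparr>"
  have imr: "r ` (?X - P) = {0..<n - j - 1}" and ims: "s ` (?Y - Q) = {n - j - 1..<n - j - 1 + j}"
    and imp: "p ` P = {0..<j}" and imq: "q ` Q = {j..<j + (n - j)}"
    using p q r s by (auto simp: bij_betw_def)
  have gP: "g u = Inl (p u)" if "u \<in> P" for u using that by (simp add: g_def)
  have gQ: "g u = Inl (q u)" if "u \<in> Q" for u using that P Q dis by (auto simp: g_def)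
  have gX: "g u = Inr (r u)" if "u \<in> ?X - P" for u using that Q dis by (auto simp: g_def)
  have gY: "g u = Inr (s u)" if "u \<in> ?Y - Q" for u using that P dis by (auto simp: g_def)
  have iP: "g ` P = Inl ` {0..<j}" unfolding imp[symmetric] image_image by (simp add: gP cong: image_cong)
  have iQ: "g ` Q = Inl ` {j..<j + (n - j)}" unfolding imq[symmetric] image_image by (simp add: gQ cong: image_cong)
  have iX: "g ` (?X - P) = Inr ` {0..<n - j - 1}" unfolding imr[symmetric] image_image
    by (rule image_cong[OF refl gX])
  have iY: "g ` (?Y - Q) = Inr ` {n - j - 1..<n - j - 1 + j}" unfolding ims[symmetric] image_image
    by (rule image_cong[OF refl gY])
  have V: "?X \<union> ?Y = P \<union> Q \<union> (?X - P) \<union> (?Y - Q)" using P Q by auto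
  have inj: "inj_on g (?X \<union> ?Y)"
  proof -
    have "inj_on g P" "inj_on g Q" "inj_on g (?X - P)" "inj_on g (?Y - Q)"
      using p q r s by (auto simp: bij_betw_def inj_on_def gP gQ gX gY)
    moreover have "g ` P \<inter> g ` Q = {}" "(g ` P \<union> g ` Q) \<inter> g ` (?X - P) = {}"
      "(g ` P \<union> g ` Q \<union> g ` (?X - P)) \<inter> g ` (?Y - Q) = {}"
      unfolding iP iQ iX iY by auto
    ultimately show ?thesis unfolding V inj_on_Un image_Un by blast
  qed
  let ?H = "edgeless j (n - j) \<squnion>\<^sub>b G0"
  have "bipartite_graph G0"
    using imr ims by (auto simp: bipartite_graph_def G0_def)
  then have "?H \<in> C_family n j" by (auto simp: C_family_def G0_def)
  moreover have "digraph_iso (graph_of B) (graph_of ?H)"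
  proof (rule digraph_iso_graph_of[OF B inj])
    show "lpart ?H \<union> rpart ?H = g ` (?X \<union> ?Y)"
      unfolding V image_Un iP iQ iX iY by (auto simp: cross_join_def edgeless_def G0_def)
    have split: "bedges B = (bedges B \<inter> (?X - P) \<times> (?Y - Q)) \<union> P \<times> (?Y - Q) \<union> (?X - P) \<times> Q"
      using none full E by auto
    have prod: "map_prod g g ` (A \<times> C) = g ` A \<times> g ` C" for A C by (auto simp: image_iff)
    have "map_prod g g ` (bedges B \<inter> (?X - P) \<times> (?Y - Q))
      = map_prod Inr Inr ` map_prod r s ` (bedges B \<inter> (?X - P) \<times> (?Y - Q))"
      unfolding image_image by (intro image_cong refl) (auto simp: gX gY)
    then have "map_prod g g ` bedges B
      = map_prod Inr Inr ` bedges G0 \<union> Inl ` {0..<j} \<times> Inr ` {n - j - 1..<n - j - 1 + j}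
        \<union> Inr ` {0..<n - j - 1} \<times> Inl ` {j..<j + (n - j)}"
      by (subst split) (simp add: image_Un prod iP iQ iX iY G0_def)
    then show "bedges ?H = map_prod g g ` bedges B"
      by (simp add: cross_join_def edgeless_def G0_def)
  qed
  ultimately show ?thesis by blast
qed

section \<open>Adding a universal vertex\<close>

lemma set_vwalk_arcs_subset_iff:
  "set (vwalk_arcs p) \<subseteq> A \<longleftrightarrow> successively (\<lambda>u w. (u, w) \<in> A) p"
  by (induction p rule: vwalk_arcs.induct) auto

definition add_universal :: "'a bigraph \<Rightarrow> 'a option bigraph" where
  "add_universal B = \<lparr>lpart = insert None (Some ` lpart B), rpart = Some ` rpart B,
     bedges = map_prod Some Some ` bedges B \<union> {None} \<times> Some ` rpart B\<rparr>"

text \<open>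
  Cutting a Hamiltonian cycle at the universal vertex leaves a Hamiltonian path of the original
  graph.
\<close>

lemma traceable_if_hamiltonian_add_universal:
  assumes "hamiltonian (bedges (add_universal B)) (lpart (add_universal B) \<union> rpart (add_universal B))"
    and "rpart B \<noteq> {}"
  shows "traceable (graph_of B)"
proof -
  let ?A = "add_universal B"
  obtain d where d: "ham_cycle (bedges ?A) (lpart ?A \<union> rpart ?A) (None # d)"
    using assms(1) ham_cycle_from[of "bedges ?A" "lpart ?A \<union> rpart ?A" _ None]
    by (auto simp: hamiltonian_def add_universal_def)
  then have dist: "distinct d" "None \<notin> set d"
    and ins: "insert None (set d) = insert None (Some ` (lpart B \<union> rpart B))"
    and succ: "successively (adj (bedges ?A)) d"
    by (auto simp: ham_cycle_def add_universal_def successively_Cons image_Un)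
  have set_d: "set d = Some ` (lpart B \<union> rpart B)"
    using insert_ident[OF dist(2), of "Some ` (lpart B \<union> rpart B)"] ins by auto
  define p where "p = map the d"
  have dp: "d = map Some p"
    unfolding p_def map_map using set_d by (intro map_idI[symmetric]) auto
  have set_p: "set p = lpart B \<union> rpart B"
    using set_d unfolding dp by (simp add: inj_image_eq_iff)
  have "adj (bedges ?A) (Some u) (Some w) \<longleftrightarrow> adj (bedges B) u w" for u w
    by (auto simp: adj_def add_universal_def)
  then have "successively (adj (bedges B)) p"
    using succ unfolding dp successively_map by simp
  then have "vpath p (graph_of B)"
    using dist set_p assms(2) unfolding vpath_def vwalk_def set_vwalk_arcs_subset_iff
    by (auto simp: dp distinct_map arcs_ends_graph_of verts_graph_of)
  then show ?thesis using set_p by (auto simp: traceable_def verts_graph_of)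
qed


lemma balanced_bipartite_add_universal:
  assumes B: "bipartite_graph B" and cards: "card (lpart B) + 1 = n" "card (rpart B) = n"
  shows "balanced_bipartite (lpart (add_universal B)) (rpart (add_universal B))
    (bedges (add_universal B)) n"
proof
  show "card (lpart (add_universal B)) = n"
    using B cards by (simp add: add_universal_def bipartite_graph_def card_image)
  show "card (rpart (add_universal B)) = n"
    using cards by (simp add: add_universal_def card_image)
qed (use B in \<open>auto simp: add_universal_def bipartite_graph_def\<close>)

lemma deg_add_universal:
  assumes B: "bipartite_graph B"
  shows "x \<in> lpart B \<Longrightarrow> deg (bedges (add_universal B)) (Some x) = deg (bedges B) x"
    and "y \<in> rpart B \<Longrightarrow> deg (bedges (add_universal B)) (Some y) = deg (bedges B) y + 1"
proof -
  have fin: "finite {w. adj (bedges B) u w}" for u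
    by (rule finite_subset[of _ "lpart B \<union> rpart B"])
       (use B in \<open>auto simp: adj_def bipartite_graph_def\<close>)
  show "deg (bedges (add_universal B)) (Some x) = deg (bedges B) x" if "x \<in> lpart B"
  proof -
    have "{w. adj (bedges (add_universal B)) (Some x) w} = Some ` {w. adj (bedges B) x w}"
      using that B by (auto simp: adj_def add_universal_def bipartite_graph_def)
    then show ?thesis by (simp add: deg_def card_image)
  qed
  show "deg (bedges (add_universal B)) (Some y) = deg (bedges B) y + 1" if "y \<in> rpart B"
  proof -
    have "{w. adj (bedges (add_universal B)) (Some y) w} = insert None (Some ` {w. adj (bedges B) y w})"
      using that by (auto simp: adj_def add_universal_def)
    then show ?thesis using fin by (simp add: deg_def card_image)
  qed
qed

section \<open>Nearly balanced graphs whose quasi-complement has small spectral radius\<close>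

theorem theorem3p10:
  fixes k n :: nat and G :: "'a bigraph"
  assumes "k \<ge> 1" and "n \<ge> 2 * k"
    and "bipartite_graph G" and "nearly_balanced G"
    and "card (verts (graph_of G)) = 2 * n - 1"
    and "min_degree (graph_of G) \<ge> k"
    and "spectral_rad (graph_of (quasi_complement G)) \<le> sqrt (real k * (real n - real k))"
  shows "traceable (graph_of G)
    \<or> (\<exists>j H. 1 \<le> j \<and> real j \<le> real n / 2 \<and> H \<in> C_family n j
          \<and> digraph_iso (graph_of G) (graph_of H))
    \<or> (\<exists>v \<in> verts (graph_of Gamma2). out_degree (graph_of Gamma2) v = 4
          \<and> digraph_iso (graph_of G) (pre_digraph.del_vert (graph_of Gamma2) v))"
proof (cases "traceable (graph_of G)")
  case False
  let ?X = "lpart G" and ?Y = "rpart G" and ?A = "add_universal G"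
  let ?X' = "lpart ?A" and ?Y' = "rpart ?A" and ?M = "bedges (quasi_complement G)"
  have finX: "finite ?X" and finY: "finite ?Y" and dis: "?X \<inter> ?Y = {}"
    and E: "bedges G \<subseteq> ?X \<times> ?Y"
    using assms(3) by (auto simp: bipartite_graph_def)
  have "card ?X + card ?Y = 2 * n - 1"
    using assms(5) finX finY dis by (simp add: verts_graph_of card_Un_disjoint)
  then have cards: "card ?X + 1 = n" "card ?Y = n"
    using assms(1,2,4) by (auto simp: nearly_balanced_def)
  then have Y_ne: "?Y \<noteq> {}" using assms(1,2) by auto
  have min_deg: "k \<le> deg (bedges G) u" if "u \<in> ?X \<union> ?Y" for u
  proof -
    have "min_degree (graph_of G) \<le> out_degree (graph_of G) u"
      unfolding min_degree_def verts_graph_of using finX finY that by (intro Min_le) auto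
    then show ?thesis using assms(6) by (simp add: out_degree_graph_of)
  qed
  have "\<not> hamiltonian (bedges ?A) (?X' \<union> ?Y')"
    using False traceable_if_hamiltonian_add_universal[of G] Y_ne by blast
  then obtain F where EF: "bedges ?A \<subseteq> F" and "balanced_bipartite ?X' ?Y' F n"
    and nonham: "\<not> hamiltonian F (?X' \<union> ?Y')"
    and maximal: "\<And>x y. x \<in> ?X' \<Longrightarrow> y \<in> ?Y' \<Longrightarrow> (x, y) \<notin> F \<Longrightarrow>
      hamiltonian (insert (x, y) F) (?X' \<union> ?Y')"
    using maximal_nonhamiltonian_extension[OF balanced_bipartite_add_universal[OF assms(3) cards]]
    by metis
  interpret F: balanced_bipartite ?X' ?Y' F n by fact
  define N' where "N' = ?X' \<times> ?Y' - F"
  define N where "N = {(x, y). (Some x, Some y) \<in> N'}"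
  have None_full: "(None, Some y) \<in> F" if "y \<in> ?Y" for y
    using EF that by (auto simp: add_universal_def)
  have N'_Some: "\<exists>x y. x' = Some x \<and> y' = Some y \<and> x \<in> ?X \<and> y \<in> ?Y" if "(x', y') \<in> N'" for x' y'
    using that None_full by (auto simp: N'_def add_universal_def)
  have N_M: "N \<subseteq> ?M" and N_sub: "N \<subseteq> ?X \<times> ?Y"
    using EF by (auto simp: N_def N'_def quasi_complement_def add_universal_def)
  have deg_N: "deg N u = deg N' (Some u)" for u
  proof -
    have "{w. adj N' (Some u) w} = Some ` {w. adj N u w}"
      using N'_Some by (fastforce simp: adj_def N_def)
    then show ?thesis by (simp add: deg_def card_image)
  qed
  have deg_NF: "deg N u + deg F (Some u) = n" if "u \<in> ?X \<union> ?Y" for u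
    using F.deg_complement[of "Some u"] that unfolding deg_N N'_def
    by (auto simp: add_universal_def)
  have n2: "n \<ge> 2" using assms(1,2) by simp
  \<comment> \<open>by maximality of \<open>F\<close>\<close>
  have path: "\<exists>v. F.zigzag v \<and> v 0 = x \<and> v (2 * n - 1) = y" if "(x, y) \<in> N'" for x y
  proof -
    have xy: "x \<in> ?X'" "y \<in> ?Y'" "(x, y) \<notin> F" using that by (auto simp: N'_def)
    show ?thesis by (rule F.zigzag_of_added_edge[OF nonham maximal[OF xy] xy(1,2) n2]) blast
  qed
  have bounds: "deg N x + k \<le> n" "deg N y + k < n" "n \<le> deg N x + deg N y"
    if xy: "(x, y) \<in> N" for x y
  proof -
    have x: "x \<in> ?X" and y: "y \<in> ?Y" using xy N_sub by auto
    have mono: "deg (bedges ?A) u \<le> deg F u" for u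
      unfolding deg_def
    proof (rule card_mono)
      show "finite {w. adj F u w}"
        by (rule finite_subset[of _ "?X' \<union> ?Y'"])
           (use F.finite_X F.finite_Y F.E_sub in \<open>auto simp: adj_def\<close>)
    qed (use EF in \<open>auto simp: adj_def\<close>)
    show "deg N x + k \<le> n"
      using deg_NF[of x] mono[of "Some x"] min_deg[of x] deg_add_universal(1)[OF assms(3) x] x
      by simp
    show "deg N y + k < n"
      using deg_NF[of y] mono[of "Some y"] min_deg[of y] deg_add_universal(2)[OF assms(3) y] y
      by simp
    obtain v where v: "F.zigzag v" "v 0 = Some x" "v (2 * n - 1) = Some y"
      using path[of "Some x" "Some y"] xy by (auto simp: N_def)
    have "deg F (Some x) + deg F (Some y) \<le> n"
      using F.crossing_deg_sum(1)[OF v(1) nonham] v n2 by simp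
    then show "n \<le> deg N x + deg N y" using deg_NF[of x] deg_NF[of y] x y by simp
  qed
  define c where "c = sqrt (real k * (real n - real k))"
  have c2: "c\<^sup>2 = real (k * (n - k))" and c0: "c > 0"
    using assms(1,2) by (simp_all add: c_def of_nat_diff)
  have qc: "bipartite_graph (quasi_complement G)"
    using finX finY dis by (auto simp: bipartite_graph_def quasi_complement_def)
  have prod: "c\<^sup>2 \<le> real (deg N x) * real (deg N y)" if "(x, y) \<in> N" for x y
    using degree_product_bound(1)[OF bounds[OF that]] unfolding c2
    by (simp only: of_nat_le_iff flip: of_nat_mult)
  note equality = spectral_equality[OF qc N_M assms(7)[folded c_def] c0 prod]
  have tight: "deg N x = n - k" "deg N y = k" if "(x, y) \<in> N" for x y
  proof -
    have "deg N x * deg N y = k * (n - k)"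
      using equality(1)[OF _ that] unfolding c2 by (simp only: of_nat_eq_iff flip: of_nat_mult)
    then show "deg N x = n - k" "deg N y = k"
      using degree_product_bound(2)[OF bounds[OF that]] by auto
  qed
  have "\<not> ?X' \<times> ?Y' \<subseteq> F" using F.complete_hamiltonian nonham n2 by auto
  then obtain x0 y0 where "(x0, y0) \<in> N'" by (auto simp: N'_def)
  moreover from N'_Some[OF this] obtain a b where "x0 = Some a" "y0 = Some b" by blast
  ultimately have ab: "(a, b) \<in> N" by (simp add: N_def)
  have k2: "2 * k < n" using bounds(2)[OF ab] tight(2)[OF ab] by simp
  obtain v where v: "F.zigzag v" "v 0 = x0" "v (2 * n - 1) = y0"
    using path[OF \<open>(x0, y0) \<in> N'\<close>] by blast
  have nadj: "\<not> adj F (v 0) (v (2 * n - 1))"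
    using \<open>(x0, y0) \<in> N'\<close> unfolding v N'_def by (simp add: F.adj_iff)
  have degF: "deg F x = k \<and> deg F y = n - k" if "x \<in> ?X'" "y \<in> ?Y'" "(x, y) \<notin> F" for x y
  proof -
    have "(x, y) \<in> N'" using that by (simp add: N'_def)
    moreover from N'_Some[OF this] obtain x1 y1
      where 1: "x = Some x1" "y = Some y1" "x1 \<in> ?X" "y1 \<in> ?Y" by blast
    ultimately have "(x1, y1) \<in> N" by (simp add: N_def)
    note deg1 = tight[OF this]
    have "deg N x1 + deg F (Some x1) = n" "deg N y1 + deg F (Some y1) = n"
      using deg_NF 1 by auto
    then show ?thesis unfolding 1 deg1 using k2 by linarith
  qed
  obtain P' Q' where PQ': "P' \<subseteq> ?X'" "card P' = k" "Q' \<subseteq> ?Y'" "card Q' = n - k" "N' = P' \<times> Q'"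
    unfolding N'_def by (rule F.extremal_nonham[OF nonham k2 assms(1) v(1) nadj degF]) auto
  have ne: "P' \<noteq> {}" "Q' \<noteq> {}" using PQ' assms(1) k2 by auto
  define P where "P = {x. Some x \<in> P'}"
  define Q where "Q = {y. Some y \<in> Q'}"
  obtain p q where pq: "p \<in> P'" "q \<in> Q'" using ne by blast
  have "\<exists>x. x' = Some x" if "x' \<in> P'" for x' using N'_Some[of x' q] that pq PQ'(5) by blast
  then have P': "P' = Some ` P" by (auto simp: P_def)
  have "\<exists>y. y' = Some y" if "y' \<in> Q'" for y' using N'_Some[of p y'] that pq PQ'(5) by blast
  then have Q': "Q' = Some ` Q" by (auto simp: Q_def)
  have NPQ: "N = P \<times> Q" using PQ'(5) by (auto simp: N_def P_def Q_def)
  have P: "P \<subseteq> ?X" "card P = k" and Q: "Q \<subseteq> ?Y" "card Q = n - k"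
    using PQ' by (auto simp: P' Q' card_image add_universal_def)
  obtain a b where "a \<in> P" "b \<in> Q" using pq P' Q' by blast
  have degP: "deg N x = 0 \<longleftrightarrow> x \<notin> P" if "x \<in> ?X" for x
  proof (cases "x \<in> P")
    case True
    then have "(x, b) \<in> N" using NPQ \<open>b \<in> Q\<close> by simp
    from tight(1)[OF this] show ?thesis using True k2 by simp
  next
    case False
    then have "{w. adj N x w} = {}" using NPQ Q dis \<open>x \<in> ?X\<close> by (auto simp: adj_def)
    then show ?thesis using False by (simp add: deg_def)
  qed
  have degQ: "deg N y = 0 \<longleftrightarrow> y \<notin> Q" if "y \<in> ?Y" for y
  proof (cases "y \<in> Q")
    case True
    then have "(a, y) \<in> N" using NPQ \<open>a \<in> P\<close> by simp
    from tight(2)[OF this] show ?thesis using True assms(1) by simp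
  next
    case False
    then have "{w. adj N y w} = {}" using NPQ P dis \<open>y \<in> ?Y\<close> by (auto simp: adj_def)
    then show ?thesis using False by (simp add: deg_def)
  qed
  \<comment> \<open>the second part of \<open>equality\<close>: nonedges of \<open>G\<close> do not leave the support of \<open>N\<close>\<close>
  have PQ_iff: "x \<in> P \<longleftrightarrow> y \<in> Q" if "x \<in> ?X" "y \<in> ?Y" "(x, y) \<notin> bedges G" for x y
    using equality(2)[of x y] that degP degQ by (auto simp: quasi_complement_def)
  have "\<exists>H \<in> C_family n k. digraph_iso (graph_of G) (graph_of H)"
  proof (rule C_family_iso[OF assms(3) _ cards(2) P Q])
    show "bedges G \<inter> P \<times> Q = {}" using N_M NPQ by (auto simp: quasi_complement_def)
    show "P \<times> (?Y - Q) \<subseteq> bedges G" "(?X - P) \<times> Q \<subseteq> bedges G" using PQ_iff P Q by blast+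
  qed (use cards k2 in auto)
  moreover have "real k \<le> real n / 2" using k2 by simp
  ultimately show ?thesis using assms(1) by blast
qed simp

end
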